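(* Let $\alpha\in\mathbb{R}$, $\theta\in(0,1)$, and let $(X_t)_{t\in\mathbb{N}}$ be given by $X_0=0$ and $X_t=\alpha+\theta X_{t-1}+\xi_t$ for $t\ge 1$, where $\xi=(\xi_t)_{t\in\mathbb{Z}}$ is a zero-mean stationary Gaussian sequence whose covariance function $R_\xi(k)=E(\xi_0\xi_k)$ satisfies $R_\xi(k)\sim C|k|^{2H-2}$ as $k\to\infty$ for some $H\in(\frac12,1)$ and some constant $C>0$. Then the moment estimators $\hat\theta_n$ and $\hat\alpha_n$ (defined in the context) are strongly consistent, i.e. $$\lim_{n\to\infty}\hat\theta_n=\theta\quad\text{a.s.},\qquad \lim_{n\to\infty}\hat\alpha_n=\alpha\quad\text{a.s.}$$
   Context: Notation: $a_k\sim b_k$ means $a_k/b_k\to1$. Put $Y_t:=\sum_{j=0}^\infty\theta^j\xi_{t-j}$, a stationary zero-mean Gaussian process. Its second moment, as a function of $\theta\in(0,1)$, is $$f(\theta):=E(Y_t^2)=\sum_{i,j=0}^\infty\theta^{i+j}R_\xi(i-j).$$ Standing assumption: $f$ is positive and strictly increasing on $(0,1)$; $f^{-1}$ denotes its inverse function, defined on the range $f((0,1))$. Let $\bar X:=\frac1n\sum_{t=1}^nX_t$. The estimators are $$\hat\theta_n:=f^{-1}\Big(\frac1n\sum_{t=1}^n(X_t-\bar X)^2\Big),\qquad \hat\alpha_n:=(1-\hat\theta_n)\bar X.$$ Convention: if $\frac1n\sum_{t=1}^n(X_t-\bar X)^2$ does not lie in $f((0,1))$, then $\hat\theta_n$ is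 assigned an arbitrary (measurable) value. *)

theory Defs
  imports "HOL-Probability.Probability"
begin

text \<open>Point masses count as Gaussian (variance zero); otherwise degenerate linear combinations
  would be excluded from Gaussian processes.\<close>

definition gaussian_rv :: "'a measure \<Rightarrow> ('a \<Rightarrow> real) \<Rightarrow> bool" where
  "gaussian_rv M Z \<longleftrightarrow> Z \<in> borel_measurable M \<and>
     ((\<exists>m. distr M borel Z = return borel m) \<or>
      (\<exists>m s. 0 < s \<and> distributed M lborel Z (normal_density m s)))"

definition gaussian_process :: "'a measure \<Rightarrow> ('i \<Rightarrow> 'a \<Rightarrow> real) \<Rightarrow> bool" where
  "gaussian_process M \<xi> \<longleftrightarrow>
     (\<forall>J c. finite J \<longrightarrow> gaussian_rv M (\<lambda>\<omega>. \<Sum>j\<in>J. c j * \<xi> j \<omega>))"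

definition zero_mean :: "'a measure \<Rightarrow> ('i \<Rightarrow> 'a \<Rightarrow> real) \<Rightarrow> bool" where
  "zero_mean M \<xi> \<longleftrightarrow> (\<forall>t. integrable M (\<xi> t) \<and> (\<integral>\<omega>. \<xi> t \<omega> \<partial>M) = 0)"

text \<open>Strict stationarity: the law on path space is invariant under every shift.\<close>

definition stationary :: "'a measure \<Rightarrow> (int \<Rightarrow> 'a \<Rightarrow> real) \<Rightarrow> bool" where
  "stationary M \<xi> \<longleftrightarrow> (\<forall>t. \<xi> t \<in> borel_measurable M) \<and>
     (\<forall>h. distr M (Pi\<^sub>M UNIV (\<lambda>_. borel)) (\<lambda>\<omega> t. \<xi> (t + h) \<omega>) =
          distr M (Pi\<^sub>M UNIV (\<lambda>_. borel)) (\<lambda>\<omega> t. \<xi> t \<omega>))"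

definition autocov :: "'a measure \<Rightarrow> (int \<Rightarrow> 'a \<Rightarrow> real) \<Rightarrow> int \<Rightarrow> real" where
  "autocov M \<xi> k = (\<integral>\<omega>. \<xi> 0 \<omega> * \<xi> k \<omega> \<partial>M)"

definition Y_process :: "(int \<Rightarrow> 'a \<Rightarrow> real) \<Rightarrow> real \<Rightarrow> int \<Rightarrow> 'a \<Rightarrow> real" where
  "Y_process \<xi> \<theta> t \<omega> = (\<Sum>j. \<theta> ^ j * \<xi> (t - int j) \<omega>)"

text \<open>The function \<open>f\<close>. The choice of time 0 is immaterial, and \<open>f\<close> is the double series over the
  covariances: see \<open>second_moment_series\<close> below.\<close>

definition second_moment :: "'a measure \<Rightarrow> (int \<Rightarrow> 'a \<Rightarrow> real) \<Rightarrow> real \<Rightarrow> real" where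
  "second_moment M \<xi> \<theta> = (\<integral>\<omega>. (Y_process \<xi> \<theta> 0 \<omega>)\<^sup>2 \<partial>M)"

definition sample_mean :: "(nat \<Rightarrow> 'a \<Rightarrow> real) \<Rightarrow> nat \<Rightarrow> 'a \<Rightarrow> real" where
  "sample_mean X n \<omega> = (1 / real n) * (\<Sum>t=1..n. X t \<omega>)"

definition sample_variance :: "(nat \<Rightarrow> 'a \<Rightarrow> real) \<Rightarrow> nat \<Rightarrow> 'a \<Rightarrow> real" where
  "sample_variance X n \<omega> = (1 / real n) * (\<Sum>t=1..n. (X t \<omega> - sample_mean X n \<omega>)\<^sup>2)"

text \<open>The argument \<open>g\<close> supplies the arbitrary value used when the sample variance lies outside
  \<open>f ` {0<..<1}\<close>.\<close>

definition theta_hat ::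
  "(real \<Rightarrow> real) \<Rightarrow> (nat \<Rightarrow> 'a \<Rightarrow> real) \<Rightarrow> (nat \<Rightarrow> 'a \<Rightarrow> real) \<Rightarrow> nat \<Rightarrow> 'a \<Rightarrow> real" where
  "theta_hat f g X n \<omega> =
     (if sample_variance X n \<omega> \<in> f ` {0<..<1}
      then the_inv_into {0<..<1} f (sample_variance X n \<omega>) else g n \<omega>)"

definition alpha_hat ::
  "(real \<Rightarrow> real) \<Rightarrow> (nat \<Rightarrow> 'a \<Rightarrow> real) \<Rightarrow> (nat \<Rightarrow> 'a \<Rightarrow> real) \<Rightarrow> nat \<Rightarrow> 'a \<Rightarrow> real" where
  "alpha_hat f g X n \<omega> = (1 - theta_hat f g X n \<omega>) * sample_mean X n \<omega>"

lemma gaussian_rv_integrable_square: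
  assumes "prob_space M" "gaussian_rv M Z"
  shows "integrable M (\<lambda>\<omega>. (Z \<omega>)\<^sup>2)"
proof -
  interpret prob_space M by fact
  have Z[measurable]: "Z \<in> borel_measurable M" using assms(2) by (simp add: gaussian_rv_def)
  from assms(2) consider (a) m where "distr M borel Z = return borel m"
    | (b) m s where "0 < s" "distributed M lborel Z (normal_density m s)"
    by (auto simp: gaussian_rv_def)
  then show ?thesis
  proof cases
    case a
    have "AE x in distr M borel Z. x = m" unfolding a by (subst AE_return) auto
    then have "AE \<omega> in M. Z \<omega> = m" by (subst (asm) AE_distr_iff) auto
    then have ae: "AE \<omega> in M. m\<^sup>2 = (Z \<omega>)\<^sup>2" by eventually_elim simp
    show ?thesis by (rule integrable_cong_AE_imp[OF _ _ ae]) auto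
  next
    case b
    have "integrable lborel (\<lambda>x. normal_density m s x * (x - m)^2 + 2*m*(normal_density m s x * x)
             - m\<^sup>2 * normal_density m s x)"
      using b(1) by (intro Bochner_Integration.integrable_add Bochner_Integration.integrable_diff
        integrable_mult_right integrable_normal_moment integrable_normal_moment_nz_1 integrable_normal_density) auto
    then have "integrable lborel (\<lambda>x. normal_density m s x * x\<^sup>2)"
      by (simp add: power2_eq_square algebra_simps)
    then show ?thesis
      by (subst (asm) distributed_integrable[OF b(2)]) auto
  qed
qed

lemma stationary_autocov:
  assumes "stationary M \<xi>"
  shows "(\<integral>\<omega>. \<xi> s \<omega> * \<xi> t \<omega> \<partial>M) = autocov M \<xi> (t - s)"
proof -
  have [measurable]: "\<And>t. \<xi> t \<in> borel_measurable M" using assms by (simp add: stationary_def)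
  have m: "(\<lambda>x. x 0 * x (t - s)) \<in> borel_measurable (Pi\<^sub>M UNIV (\<lambda>_::int. borel :: real measure))"
    by measurable
  have p: "(\<lambda>\<omega> t. \<xi> (t + h) \<omega>) \<in> measurable M (Pi\<^sub>M UNIV (\<lambda>_. borel))" for h
    by (rule measurable_PiM_single') auto
  have "(\<integral>\<omega>. \<xi> (0 + s) \<omega> * \<xi> ((t - s) + s) \<omega> \<partial>M) =
        (\<integral>x. x 0 * x (t - s) \<partial>distr M (Pi\<^sub>M UNIV (\<lambda>_. borel)) (\<lambda>\<omega> t. \<xi> (t + s) \<omega>))"
    by (rule integral_distr[OF p m, symmetric])
  also have "\<dots> = (\<integral>x. x 0 * x (t - s) \<partial>distr M (Pi\<^sub>M UNIV (\<lambda>_. borel)) (\<lambda>\<omega> t. \<xi> t \<omega>))"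
    using assms unfolding stationary_def by metis
  also have "\<dots> = (\<integral>\<omega>. \<xi> 0 \<omega> * \<xi> (t - s) \<omega> \<partial>M)"
    using integral_distr[OF p[of 0] m] by simp
  finally show ?thesis by (simp add: autocov_def)
qed

lemma second_moment_series:
  assumes "prob_space M" "gaussian_process M \<xi>" "stationary M \<xi>" "0 < \<theta>" "\<theta> < 1"
  shows "AE \<omega> in M. summable (\<lambda>j. \<theta> ^ j * \<xi> (t - int j) \<omega>)"
    and "(\<integral>\<omega>. (Y_process \<xi> \<theta> t \<omega>)\<^sup>2 \<partial>M) = (\<Sum>i. \<Sum>j. \<theta> ^ (i + j) * autocov M \<xi> (int i - int j))"
proof -
  interpret prob_space M by fact
  have meas[measurable]: "\<And>t. \<xi> t \<in> borel_measurable M" using assms by (simp add: stationary_def)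
  define R where "R = autocov M \<xi> 0"
  have gp: "gaussian_rv M (\<xi> s)" for s
    using assms(2)[unfolded gaussian_process_def, rule_format, of "{s}" "\<lambda>_. 1"] by simp
  have sq: "integrable M (\<lambda>\<omega>. (\<xi> s \<omega>)\<^sup>2)" for s
    by (rule gaussian_rv_integrable_square[OF assms(1) gp])
  have sqR: "(\<integral>\<omega>. (\<xi> s \<omega>)\<^sup>2 \<partial>M) = R" for s
    using stationary_autocov[OF assms(3), of s s] by (simp add: power2_eq_square R_def)
  have ab: "\<bar>a * b\<bar> \<le> a\<^sup>2 + b\<^sup>2" for a b :: real
  proof -
    have "2 * (\<bar>a\<bar> * \<bar>b\<bar>) \<le> \<bar>a\<bar>\<^sup>2 + \<bar>b\<bar>\<^sup>2"
      using sum_squares_bound[of "\<bar>a\<bar>" "\<bar>b\<bar>"] by simp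
    moreover have "0 \<le> \<bar>a\<bar> * \<bar>b\<bar>" by simp
    ultimately show ?thesis unfolding abs_mult power2_abs by linarith
  qed
  have ip: "integrable M (\<lambda>\<omega>. \<xi> s \<omega> * \<xi> u \<omega>)" for s u
  proof (rule Bochner_Integration.integrable_bound[OF Bochner_Integration.integrable_add[OF sq[of s] sq[of u]]])
    have "norm (\<xi> s \<omega> * \<xi> u \<omega>) \<le> norm ((\<xi> s \<omega>)\<^sup>2 + (\<xi> u \<omega>)\<^sup>2)" for \<omega>
      using ab[of "\<xi> s \<omega>" "\<xi> u \<omega>"] unfolding real_norm_def by linarith
    then show "AE \<omega> in M. norm (\<xi> s \<omega> * \<xi> u \<omega>) \<le> norm ((\<xi> s \<omega>)\<^sup>2 + (\<xi> u \<omega>)\<^sup>2)"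
      by (intro AE_I2)
  qed measurable
  have nb: "(\<integral>\<omega>. \<bar>\<xi> s \<omega> * \<xi> u \<omega>\<bar> \<partial>M) \<le> 2 * R" for s u
  proof -
    have "(\<integral>\<omega>. \<bar>\<xi> s \<omega> * \<xi> u \<omega>\<bar> \<partial>M) \<le> (\<integral>\<omega>. (\<xi> s \<omega>)\<^sup>2 + (\<xi> u \<omega>)\<^sup>2 \<partial>M)"
      by (intro integral_mono integrable_abs ip Bochner_Integration.integrable_add sq ab)
    also have "\<dots> = 2 * R" by (simp add: sq sqR)
    finally show ?thesis .
  qed
  have geo: "summable (\<lambda>j. \<theta> ^ j * c)" for c :: real
    using assms(4,5) by (intro summable_mult2 summable_geometric) auto
  define e where "e j \<omega> = \<theta> ^ j * \<xi> (t - int j) \<omega>" for j \<omega>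
  have em[measurable]: "e j \<in> borel_measurable M" for j unfolding e_def by measurable
  have ab1: "\<bar>a\<bar> \<le> 1 + a\<^sup>2" for a :: real
    using ab[of a 1] by simp
  have int1: "integrable M (\<lambda>\<omega>. 1 + (\<xi> s \<omega>)\<^sup>2)" for s
    by (intro Bochner_Integration.integrable_add sq) simp
  have i1: "integrable M (\<lambda>\<omega>. \<bar>\<xi> s \<omega>\<bar>)" for s
  proof (rule Bochner_Integration.integrable_bound[OF int1[of s]])
    have "norm \<bar>\<xi> s \<omega>\<bar> \<le> norm (1 + (\<xi> s \<omega>)\<^sup>2)" for \<omega>
      using ab1[of "\<xi> s \<omega>"] unfolding real_norm_def by linarith
    then show "AE \<omega> in M. norm \<bar>\<xi> s \<omega>\<bar> \<le> norm (1 + (\<xi> s \<omega>)\<^sup>2)"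
      by (intro AE_I2)
  qed measurable
  have n1: "(\<integral>\<omega>. \<bar>\<xi> s \<omega>\<bar> \<partial>M) \<le> 1 + R" for s
  proof -
    have "(\<integral>\<omega>. \<bar>\<xi> s \<omega>\<bar> \<partial>M) \<le> (\<integral>\<omega>. 1 + (\<xi> s \<omega>)\<^sup>2 \<partial>M)"
      by (intro integral_mono i1 int1 ab1)
    also have "\<dots> = 1 + R" by (simp add: sq sqR prob_space)
    finally show ?thesis .
  qed
  have ie: "integrable M (\<lambda>\<omega>. \<bar>e j \<omega>\<bar>)" for j
    using i1 assms(4) by (simp add: e_def abs_mult)
  have ae: "AE \<omega> in M. summable (\<lambda>j. \<bar>e j \<omega>\<bar>)"
  proof -
    have b: "(\<integral>\<omega>. \<bar>e j \<omega>\<bar> \<partial>M) \<le> \<theta> ^ j * (1 + R)" for j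
      using n1[of "t - int j"] assms(4) by (simp add: e_def abs_mult)
    have "(\<integral>\<^sup>+\<omega>. (\<Sum>j. ennreal \<bar>e j \<omega>\<bar>) \<partial>M) = (\<Sum>j. \<integral>\<^sup>+\<omega>. ennreal \<bar>e j \<omega>\<bar> \<partial>M)"
      by (rule nn_integral_suminf) auto
    also have "\<dots> = (\<Sum>j. ennreal (\<integral>\<omega>. \<bar>e j \<omega>\<bar> \<partial>M))"
      by (intro suminf_cong nn_integral_eq_integral ie) auto
    also have "\<dots> \<le> (\<Sum>j. ennreal (\<theta> ^ j * (1 + R)))"
      by (intro suminf_le ennreal_leI b) auto
    also have "\<dots> = ennreal (\<Sum>j. \<theta> ^ j * (1 + R))"
    proof (rule suminf_ennreal2[OF _ geo])
      have "0 \<le> 1 + R" unfolding sqR[of 0, symmetric] by (intro add_nonneg_nonneg Bochner_Integration.integral_nonneg) auto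
      then show "0 \<le> \<theta> ^ j * (1 + R)" for j using assms(4) by simp
    qed
    also have "\<dots> < \<infinity>" by simp
    finally have "(\<integral>\<^sup>+\<omega>. (\<Sum>j. ennreal \<bar>e j \<omega>\<bar>) \<partial>M) \<noteq> \<infinity>" by simp
    then have "AE \<omega> in M. (\<Sum>j. ennreal \<bar>e j \<omega>\<bar>) \<noteq> \<infinity>"
      by (intro nn_integral_PInf_AE) auto
    then show ?thesis
      by eventually_elim (auto intro!: summable_suminf_not_top)
  qed
  then show "AE \<omega> in M. summable (\<lambda>j. \<theta> ^ j * \<xi> (t - int j) \<omega>)"
    by eventually_elim (auto simp: e_def dest: summable_rabs_cancel)
  define Y where "Y = Y_process \<xi> \<theta> t"
  have Ye: "Y \<omega> = (\<Sum>j. e j \<omega>)" for \<omega> by (simp add: Y_def Y_process_def e_def)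
  have inn: "integrable M (\<lambda>\<omega>. e i \<omega> * e j \<omega>)" for i j
    using ip[of "t - int i" "t - int j"] by (simp add: e_def mult_ac)
  have nee: "(\<integral>\<omega>. \<bar>e i \<omega> * e j \<omega>\<bar> \<partial>M) \<le> \<theta> ^ j * (\<theta> ^ i * (2 * R))" for i j
  proof -
    have "(\<integral>\<omega>. \<bar>e i \<omega> * e j \<omega>\<bar> \<partial>M)
        = (\<integral>\<omega>. (\<theta> ^ j * \<theta> ^ i) * \<bar>\<xi> (t - int i) \<omega> * \<xi> (t - int j) \<omega>\<bar> \<partial>M)"
      using assms(4) by (intro Bochner_Integration.integral_cong) (auto simp: e_def abs_mult)
    also have "\<dots> = (\<theta> ^ j * \<theta> ^ i) * (\<integral>\<omega>. \<bar>\<xi> (t - int i) \<omega> * \<xi> (t - int j) \<omega>\<bar> \<partial>M)" by simp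
    also have "\<dots> \<le> (\<theta> ^ j * \<theta> ^ i) * (2 * R)"
      using assms(4) nb by (intro mult_left_mono) auto
    finally show ?thesis by (simp add: mult_ac)
  qed
  have s1: "summable (\<lambda>j. \<integral>\<omega>. \<bar>e i \<omega> * e j \<omega>\<bar> \<partial>M)" for i
    by (rule summable_comparison_test'[OF geo[of "\<theta> ^ i * (2 * R)"], of 0]) (use nee in auto)
  have ae1: "AE \<omega> in M. summable (\<lambda>j. norm (e i \<omega> * e j \<omega>))" for i
    using ae by eventually_elim (auto simp: abs_mult intro!: summable_mult)
  have eY: "AE \<omega> in M. (\<Sum>j. e i \<omega> * e j \<omega>) = e i \<omega> * Y \<omega>" for i
    using ae by eventually_elim (auto simp: Ye intro!: suminf_mult summable_rabs_cancel)
  have Ym[measurable]: "Y \<in> borel_measurable M" unfolding Ye[abs_def] by measurable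
  have s1': "summable (\<lambda>j. \<integral>\<omega>. norm (e i \<omega> * e j \<omega>) \<partial>M)" for i using s1[of i] by simp
  have ieY: "integrable M (\<lambda>\<omega>. e i \<omega> * Y \<omega>)" for i
    by (rule integrable_cong_AE_imp[OF integrable_suminf[OF inn ae1 s1'] _ eY]) measurable
  have veY: "(\<integral>\<omega>. e i \<omega> * Y \<omega> \<partial>M) = (\<Sum>j. \<integral>\<omega>. e i \<omega> * e j \<omega> \<partial>M)" for i
  proof -
    have "(\<integral>\<omega>. (\<Sum>j. e i \<omega> * e j \<omega>) \<partial>M) = (\<integral>\<omega>. e i \<omega> * Y \<omega> \<partial>M)"
      by (rule integral_cong_AE[OF _ _ eY]) measurable
    then show ?thesis using integral_suminf[OF inn ae1 s1', of i] by simp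
  qed
  have neY: "(\<integral>\<omega>. \<bar>e i \<omega> * Y \<omega>\<bar> \<partial>M) \<le> \<theta> ^ i * (2 * R / (1 - \<theta>))" for i
  proof -
    have ia: "integrable M (\<lambda>\<omega>. \<bar>e i \<omega> * e j \<omega>\<bar>)" for j by (intro integrable_abs inn)
    have aa: "AE \<omega> in M. summable (\<lambda>j. norm \<bar>e i \<omega> * e j \<omega>\<bar>)" using ae1[of i] by simp
    have ss: "summable (\<lambda>j. \<integral>\<omega>. norm \<bar>e i \<omega> * e j \<omega>\<bar> \<partial>M)" using s1[of i] by simp
    have "AE \<omega> in M. \<bar>e i \<omega> * Y \<omega>\<bar> \<le> (\<Sum>j. \<bar>e i \<omega> * e j \<omega>\<bar>)"
      using eY[of i] ae1[of i]
    proof eventually_elim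
      case (elim \<omega>)
      show ?case using summable_norm[OF elim(2)] unfolding elim(1) real_norm_def .
    qed
    then have "(\<integral>\<omega>. \<bar>e i \<omega> * Y \<omega>\<bar> \<partial>M) \<le> (\<integral>\<omega>. (\<Sum>j. \<bar>e i \<omega> * e j \<omega>\<bar>) \<partial>M)"
      by (intro integral_mono_AE integrable_abs ieY integrable_suminf[OF ia aa ss])
    also have "\<dots> = (\<Sum>j. \<integral>\<omega>. \<bar>e i \<omega> * e j \<omega>\<bar> \<partial>M)" by (rule integral_suminf[OF ia aa ss])
    also have "\<dots> \<le> (\<Sum>j. \<theta> ^ j * (\<theta> ^ i * (2 * R)))" by (intro suminf_le nee s1 geo)
    also have "\<dots> = \<theta> ^ i * (2 * R / (1 - \<theta>))"
    proof -
      have n: "norm \<theta> < 1" using assms(4,5) by simp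
      show ?thesis
        unfolding suminf_mult2[OF summable_geometric[OF n], symmetric] suminf_geometric[OF n] by simp
    qed
    finally show ?thesis .
  qed
  have s2: "summable (\<lambda>i. \<integral>\<omega>. norm (e i \<omega> * Y \<omega>) \<partial>M)"
    by (rule summable_comparison_test'[OF geo[of "2 * R / (1 - \<theta>)"], of 0]) (use neY in auto)
  have ae2: "AE \<omega> in M. summable (\<lambda>i. norm (e i \<omega> * Y \<omega>))"
    using ae by eventually_elim (auto simp: abs_mult intro!: summable_mult2)
  have YY: "AE \<omega> in M. (\<Sum>i. e i \<omega> * Y \<omega>) = (Y \<omega>)\<^sup>2"
    using ae
  proof eventually_elim
    case (elim \<omega>)
    show ?case
      using suminf_mult2[OF summable_rabs_cancel[OF elim], of "Y \<omega>"] by (simp add: Ye power2_eq_square)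
  qed
  have "(\<integral>\<omega>. (Y \<omega>)\<^sup>2 \<partial>M) = (\<integral>\<omega>. (\<Sum>i. e i \<omega> * Y \<omega>) \<partial>M)"
    using YY by (intro integral_cong_AE) auto
  also have "\<dots> = (\<Sum>i. \<integral>\<omega>. e i \<omega> * Y \<omega> \<partial>M)" by (rule integral_suminf[OF ieY ae2 s2])
  also have "\<dots> = (\<Sum>i. \<Sum>j. \<integral>\<omega>. e i \<omega> * e j \<omega> \<partial>M)" by (simp add: veY)
  also have "\<dots> = (\<Sum>i. \<Sum>j. \<theta> ^ (i + j) * autocov M \<xi> (int i - int j))"
  proof -
    have "(\<integral>\<omega>. e i \<omega> * e j \<omega> \<partial>M) = \<theta> ^ (i + j) * autocov M \<xi> (int i - int j)" for i j
    proof -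
      have "(\<integral>\<omega>. e i \<omega> * e j \<omega> \<partial>M)
          = (\<integral>\<omega>. \<theta> ^ (i + j) * (\<xi> (t - int i) \<omega> * \<xi> (t - int j) \<omega>) \<partial>M)"
        by (intro Bochner_Integration.integral_cong) (auto simp: e_def power_add)
      also have "\<dots> = \<theta> ^ (i + j) * autocov M \<xi> (int i - int j)"
        using stationary_autocov[OF assms(3), of "t - int i" "t - int j"] by simp
      finally show ?thesis .
    qed
    then show ?thesis by simp
  qed
  finally show "(\<integral>\<omega>. (Y_process \<xi> \<theta> t \<omega>)\<^sup>2 \<partial>M) = (\<Sum>i. \<Sum>j. \<theta> ^ (i + j) * autocov M \<xi> (int i - int j))"
    by (simp add: Y_def)
qed

end

theory Submission
  imports Defs
begin

text \<open>With \<open>\<mu> = \<alpha> / (1 - \<theta>)\<close> one has \<open>X\<^sub>t = \<mu> (1 - \<theta>\<^sup>t) + Z\<^sub>t\<close>, where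
  \<open>Z\<^sub>t = \<Sum>a=1..t. \<theta>\<^sup>t\<^sup>-\<^sup>a \<xi>\<^sub>a\<close> is a finite, hence Gaussian, combination of the noise; working with
  \<open>Z\<close> instead of the stationary solution \<open>Y\<close> avoids Gaussianity of infinite sums. The Gaussian
  identity \<open>Cov(U\<^sup>2, V\<^sup>2) = 2 Cov(U, V)\<^sup>2\<close> and \<open>\<bar>R k\<bar> \<le> A k powr (2H - 2)\<close> bound the second moments of
  the centred sums of \<open>Z\<^sub>t\<close> and \<open>Z\<^sub>t\<^sup>2\<close> up to \<open>n\<close> by a multiple of \<open>n powr 2H\<close>. Since \<open>2H < 2\<close>, the averages
  converge almost surely along \<open>n = k\<^sup>p\<close> for large \<open>p\<close>, and nonnegativity of the summands fills the gaps.
  As \<open>E Z\<^sub>t\<^sup>2\<close> tends to \<open>f \<theta>\<close>, the sample variance converges to \<open>f \<theta>\<close>. The truncated double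
  series converge to \<open>f\<close> locally uniformly, so \<open>f\<close> is continuous and its inverse is defined and
  continuous near \<open>f \<theta>\<close>.\<close>

section \<open>Fourth moments of Gaussian variables\<close>

text \<open>Zero mean forces a point mass to sit at 0, where both sides vanish, and a normal law to
  have \<open>m = 0\<close>, where the even moments \<open>s\<^sup>2\<close> and
  \<open>3 * s ^ 4\<close> are explicit.\<close>

lemma gaussian_rv_fourth_moment:
  assumes "prob_space M" "gaussian_rv M Z" "(\<integral>\<omega>. Z \<omega> \<partial>M) = 0"
  shows "integrable M (\<lambda>\<omega>. Z \<omega> ^ 4)"
    and "(\<integral>\<omega>. Z \<omega> ^ 4 \<partial>M) = 3 * (\<integral>\<omega>. (Z \<omega>)\<^sup>2 \<partial>M)\<^sup>2"
proof -
  interpret prob_space M by fact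
  have Z[measurable]: "Z \<in> borel_measurable M" using assms(2) by (simp add: gaussian_rv_def)
  from assms(2) consider (a) m where "distr M borel Z = return borel m"
    | (b) m s where "0 < s" "distributed M lborel Z (normal_density m s)"
    by (auto simp: gaussian_rv_def)
  then have "integrable M (\<lambda>\<omega>. Z \<omega> ^ 4) \<and>
      (\<integral>\<omega>. Z \<omega> ^ 4 \<partial>M) = 3 * (\<integral>\<omega>. (Z \<omega>)\<^sup>2 \<partial>M)\<^sup>2"
  proof cases
    case a
    have "AE x in distr M borel Z. x = m" unfolding a by (subst AE_return) auto
    then have m: "AE \<omega> in M. Z \<omega> = m" by (subst (asm) AE_distr_iff) auto
    then have "(\<integral>\<omega>. Z \<omega> \<partial>M) = (\<integral>\<omega>. m \<partial>M)" by (intro integral_cong_AE) auto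
    with assms(3) have "m = 0" by (simp add: prob_space)
    with m have 0: "AE \<omega> in M. Z \<omega> = 0" by simp
    have "AE \<omega> in M. 0 = Z \<omega> ^ 4" "AE \<omega> in M. (Z \<omega>)\<^sup>2 = 0" using 0 by auto
    moreover have "(\<integral>\<omega>. Z \<omega> ^ 4 \<partial>M) = (\<integral>\<omega>. 0 \<partial>M)"
      using 0 by (intro integral_cong_AE) auto
    moreover have "(\<integral>\<omega>. (Z \<omega>)\<^sup>2 \<partial>M) = (\<integral>\<omega>. 0 \<partial>M)"
      using 0 by (intro integral_cong_AE) auto
    ultimately show ?thesis by (auto intro: integrable_cong_AE_imp[where g = "\<lambda>_. 0"])
  next
    case b
    have "(\<integral>\<omega>. Z \<omega> \<partial>M) = (\<integral>x. normal_density m s x * x \<partial>lborel)"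
      by (subst distributed_integral[OF b(2)]) auto
    also have "\<dots> = m" using integral_normal_moment_nz_1[OF b(1), of m] by simp
    finally have "m = 0" using assms(3) by simp
    with b have d: "distributed M lborel Z (normal_density 0 s)" by simp
    have 4: "has_bochner_integral lborel (\<lambda>x. normal_density 0 s x * x ^ 4) (3 * s ^ 4)"
      using normal_moment_even[OF b(1), of 0 2] by (simp add: fact_numeral power_divide)
    have 2: "has_bochner_integral lborel (\<lambda>x. normal_density 0 s x * x\<^sup>2) (s\<^sup>2)"
      using normal_moment_even[OF b(1), of 0 1] by (simp add: fact_numeral)
    have "integrable M (\<lambda>\<omega>. Z \<omega> ^ 4)"
      using has_bochner_integral_iff[THEN iffD1, OF 4] distributed_integrable[OF d, of "\<lambda>x. x ^ 4"] by simp
    moreover have "(\<integral>\<omega>. Z \<omega> ^ 4 \<partial>M) = 3 * s ^ 4"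
      using has_bochner_integral_iff[THEN iffD1, OF 4] distributed_integral[OF d, of "\<lambda>x. x ^ 4"] by simp
    moreover have "(\<integral>\<omega>. (Z \<omega>)\<^sup>2 \<partial>M) = s\<^sup>2"
      using has_bochner_integral_iff[THEN iffD1, OF 2] distributed_integral[OF d, of "\<lambda>x. x\<^sup>2"] by simp
    ultimately show ?thesis by (simp flip: power_mult)
  qed
  then show "integrable M (\<lambda>\<omega>. Z \<omega> ^ 4)" "(\<integral>\<omega>. Z \<omega> ^ 4 \<partial>M) = 3 * (\<integral>\<omega>. (Z \<omega>)\<^sup>2 \<partial>M)\<^sup>2"
    by auto
qed

text \<open>Isserlis' identity for a pair, which may be degenerate. Joint Gaussianity enters as
  Gaussianity of all linear combinations, so no bivariate density is involved.\<close>

lemma gaussian_square_product_moment: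
  assumes "prob_space M" and g: "\<And>a b. gaussian_rv M (\<lambda>\<omega>. a * U \<omega> + b * V \<omega>)"
    and "(\<integral>\<omega>. U \<omega> \<partial>M) = 0" "(\<integral>\<omega>. V \<omega> \<partial>M) = 0"
  shows "integrable M (\<lambda>\<omega>. (U \<omega>)\<^sup>2 * (V \<omega>)\<^sup>2)"
    and "(\<integral>\<omega>. (U \<omega>)\<^sup>2 * (V \<omega>)\<^sup>2 \<partial>M) =
      (\<integral>\<omega>. (U \<omega>)\<^sup>2 \<partial>M) * (\<integral>\<omega>. (V \<omega>)\<^sup>2 \<partial>M) + 2 * (\<integral>\<omega>. U \<omega> * V \<omega> \<partial>M)\<^sup>2"
proof -
  interpret prob_space M by fact
  have gU: "gaussian_rv M U" and gV: "gaussian_rv M V" using g[of 1 0] g[of 0 1] by auto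
  have [measurable]: "U \<in> borel_measurable M" "V \<in> borel_measurable M"
    using gU gV by (auto simp: gaussian_rv_def)
  note sq = gaussian_rv_integrable_square[OF assms(1)]
  have iU: "integrable M U" and iV: "integrable M V"
    using sq[OF gU] sq[OF gV] by (auto intro: square_integrable_imp_integrable)
  have mean: "(\<integral>\<omega>. a * U \<omega> + b * V \<omega> \<partial>M) = 0" for a b
    using iU iV assms by simp
  note m4 = gaussian_rv_fourth_moment[OF assms(1) g mean]
  define A where "A = (\<integral>\<omega>. (U \<omega>)\<^sup>2 \<partial>M)"
  define B where "B = (\<integral>\<omega>. (V \<omega>)\<^sup>2 \<partial>M)"
  define c where "c = (\<integral>\<omega>. U \<omega> * V \<omega> \<partial>M)"
  have iUV: "integrable M (\<lambda>\<omega>. U \<omega> * V \<omega>)"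
  proof -
    have "integrable M (\<lambda>\<omega>. ((1 * U \<omega> + 1 * V \<omega>)\<^sup>2 - (1 * U \<omega> + (-1) * V \<omega>)\<^sup>2) / 4)"
      by (intro Bochner_Integration.integrable_diff integrable_divide_zero sq g)
    then show ?thesis by (simp add: power2_eq_square algebra_simps)
  qed
  have m2: "(\<integral>\<omega>. (a * U \<omega> + b * V \<omega>)\<^sup>2 \<partial>M) = a\<^sup>2 * A + 2 * a * b * c + b\<^sup>2 * B" for a b
  proof -
    have "(\<integral>\<omega>. (a * U \<omega> + b * V \<omega>)\<^sup>2 \<partial>M)
      = (\<integral>\<omega>. a\<^sup>2 * (U \<omega>)\<^sup>2 + (2 * a * b) * (U \<omega> * V \<omega>) + b\<^sup>2 * (V \<omega>)\<^sup>2 \<partial>M)"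
      by (intro Bochner_Integration.integral_cong) (auto simp: power2_eq_square algebra_simps)
    then show ?thesis using iUV sq[OF gU] sq[OF gV] by (simp add: A_def B_def c_def)
  qed
  \<comment> \<open>Polarization reduces the mixed moment to fourth moments of linear combinations.\<close>
  have eq: "(U \<omega>)\<^sup>2 * (V \<omega>)\<^sup>2 = ((1 * U \<omega> + 1 * V \<omega>) ^ 4 + (1 * U \<omega> + (-1) * V \<omega>) ^ 4
      - 2 * (1 * U \<omega> + 0 * V \<omega>) ^ 4 - 2 * (0 * U \<omega> + 1 * V \<omega>) ^ 4) / 12" for \<omega>
    by (simp add: power4_eq_xxxx power2_eq_square algebra_simps)
  show "integrable M (\<lambda>\<omega>. (U \<omega>)\<^sup>2 * (V \<omega>)\<^sup>2)"
    unfolding eq by (intro Bochner_Integration.integrable_diff Bochner_Integration.integrable_add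
        integrable_divide_zero integrable_mult_right m4)
  have "(\<integral>\<omega>. (U \<omega>)\<^sup>2 * (V \<omega>)\<^sup>2 \<partial>M) = (3 * (A + 2 * c + B)\<^sup>2 + 3 * (A - 2 * c + B)\<^sup>2 - 6 * A\<^sup>2 - 6 * B\<^sup>2) / 12"
    unfolding eq using m4[of 1 1] m4[of 1 "-1"] m4[of 1 0] m4[of 0 1] m2[of 1 1] m2[of 1 "-1"] m2[of 1 0] m2[of 0 1]
    by simp
  also have "\<dots> = A * B + 2 * c\<^sup>2" by (simp add: power2_eq_square algebra_simps)
  finally show "(\<integral>\<omega>. (U \<omega>)\<^sup>2 * (V \<omega>)\<^sup>2 \<partial>M) =
      (\<integral>\<omega>. (U \<omega>)\<^sup>2 \<partial>M) * (\<integral>\<omega>. (V \<omega>)\<^sup>2 \<partial>M) + 2 * (\<integral>\<omega>. U \<omega> * V \<omega> \<partial>M)\<^sup>2"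
    by (simp add: A_def B_def c_def)
qed

section \<open>Almost sure convergence of averages\<close>

lemma LIMSEQ_cesaro:
  fixes a :: "nat \<Rightarrow> real"
  assumes "a \<longlonglongrightarrow> l"
  shows "(\<lambda>n. (\<Sum>t=1..n. a t) / real n) \<longlonglongrightarrow> l"
proof (rule LIMSEQ_I)
  fix e :: real assume "0 < e"
  then obtain N where N: "\<And>t. N \<le> t \<Longrightarrow> \<bar>a t - l\<bar> < e / 2"
    using LIMSEQ_D[OF assms, of "e / 2"] by auto
  define c where "c = (\<Sum>t=1..N. \<bar>a t - l\<bar>)"
  \<comment> \<open>For \<open>n \<ge> M\<close> the first \<open>N\<close> terms contribute less
    than \<open>e / 2\<close> to the average; the later ones contribute at most
    \<open>e / 2\<close>.\<close>
  obtain M :: nat where M: "2 * c / e < real M" using reals_Archimedean2 by blast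
  show "\<exists>n0. \<forall>n\<ge>n0. norm ((\<Sum>t=1..n. a t) / real n - l) < e"
  proof (intro exI[of _ "max 1 (max N M)"] allI impI)
    fix n assume n: "max 1 (max N M) \<le> n"
    have "(\<Sum>t=1..n. a t) / real n - l = (\<Sum>t=1..n. a t - l) / real n"
      using n by (simp add: sum_subtractf field_simps)
    also have "\<bar>\<dots>\<bar> \<le> (\<Sum>t=1..n. \<bar>a t - l\<bar>) / real n"
      by (simp add: abs_divide divide_right_mono sum_abs)
    also have "(\<Sum>t=1..n. \<bar>a t - l\<bar>) = c + (\<Sum>t\<in>{N<..n}. \<bar>a t - l\<bar>)"
    proof -
      have "{1..n} = {1..N} \<union> {N<..n}" using n by auto
      show ?thesis unfolding c_def \<open>{1..n} = _\<close> by (rule sum.union_disjoint) auto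
    qed
    also have "(\<Sum>t\<in>{N<..n}. \<bar>a t - l\<bar>) \<le> (\<Sum>t\<in>{N<..n}. e / 2)"
      using N by (intro sum_mono) (auto intro: less_imp_le)
    also have "\<dots> \<le> real n * (e / 2)" using \<open>0 < e\<close> by simp
    also have "(c + real n * (e / 2)) / real n < e"
    proof -
      have "2 * c < real M * e" using M \<open>0 < e\<close> by (simp add: field_simps)
      also have "\<dots> \<le> real n * e" using n \<open>0 < e\<close> by simp
      finally show ?thesis using n by (simp add: field_simps)
    qed
    finally show "norm ((\<Sum>t=1..n. a t) / real n - l) < e" by (simp add: divide_right_mono)
  qed
qed

text \<open>A sparse subsequence suffices: the centred sum can fall by at most \<open>B\<close> per
  step, and consecutive values of \<open>k^p\<close> have ratio tending to 1, so the possible fall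
  across a block is negligible relative to \<open>k^p\<close>.\<close>

lemma cesaro_interpolation:
  fixes w m :: "nat \<Rightarrow> real"
  assumes w: "\<And>t. 0 \<le> w t" and m: "\<And>t. \<bar>m t\<bar> \<le> B" and "0 < p"
    and lim: "(\<lambda>k. (\<Sum>t=1..k^p. w t - m t) / real (k^p)) \<longlonglongrightarrow> 0"
  shows "(\<lambda>n. (\<Sum>t=1..n. w t - m t) / real n) \<longlonglongrightarrow> 0"
proof -
  define D where "D n = (\<Sum>t=1..n. w t - m t)" for n
  define T where "T k = D (k^p) / real (k^p)" for k
  define \<rho> where "\<rho> k = real (Suc k ^ p) / real (k ^ p)" for k
  \<comment> \<open>Bound for the average at any \<open>n\<close> between \<open>k^p\<close> and
    \<open>Suc k ^ p\<close>: the two endpoint averages, the right one rescaled by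
    \<open>\<rho> k\<close> because the division is by \<open>k^p\<close>, plus the drift
    \<open>B\<close> times the relative block length.\<close>
  define E where "E k = \<bar>T k\<bar> + \<bar>T (Suc k)\<bar> * \<rho> k + B * (\<rho> k - 1)" for k
  have B: "0 \<le> B" using m[of 0] by linarith
  \<comment> \<open>\<open>D n + B * n\<close> is monotone, so between \<open>k^p\<close> and \<open>Suc k ^ p\<close> the sum \<open>D\<close> is squeezed.\<close>
  have mono: "D n1 - B * (real n2 - real n1) \<le> D n2" if "n1 \<le> n2" for n1 n2
    using that
  proof (induction n2 rule: dec_induct)
    case (step n)
    have "D (Suc n) = D n + (w (Suc n) - m (Suc n))" by (simp add: D_def)
    with step w[of "Suc n"] m[of "Suc n"] show ?case by (simp add: algebra_simps)
  qed simp
  have bound: "\<bar>D n / real n\<bar> \<le> E k" if "1 \<le> k" "k^p \<le> n" "n \<le> Suc k ^ p" for n k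
  proof -
    let ?a = "real (k^p)" and ?b = "real (Suc k ^ p)"
    have a: "0 < ?a" using that by simp
    have ab: "?a \<le> real n" "real n \<le> ?b" using that by (auto simp only: of_nat_le_iff)
    have "B * (?b - real n) \<le> B * (?b - ?a)" "B * (real n - ?a) \<le> B * (?b - ?a)"
      using ab B by (auto intro!: mult_left_mono)
    with mono[OF that(2)] mono[OF that(3)]
    have "\<bar>D n\<bar> \<le> \<bar>D (k^p)\<bar> + \<bar>D (Suc k ^ p)\<bar> + B * (?b - ?a)" by linarith
    moreover have "\<bar>D n / real n\<bar> \<le> \<bar>D n\<bar> / ?a"
      using ab a less_le_trans[OF a ab(1)] unfolding abs_divide abs_of_nat
      by (intro divide_left_mono mult_pos_pos) auto
    ultimately have "\<bar>D n / real n\<bar> \<le> (\<bar>D (k^p)\<bar> + \<bar>D (Suc k ^ p)\<bar> + B * (?b - ?a)) / ?a"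
      using a by (meson divide_right_mono less_imp_le order_trans)
    also have "\<dots> = E k"
    proof -
      have b: "?b \<noteq> 0" by (simp del: of_nat_power of_nat_Suc)
      have "\<bar>D (k^p)\<bar> / ?a = \<bar>T k\<bar>" using a by (simp add: T_def abs_divide del: of_nat_power)
      moreover have "\<bar>D (Suc k ^ p)\<bar> / ?a = \<bar>T (Suc k)\<bar> * \<rho> k"
        using b by (simp add: T_def \<rho>_def abs_divide del: of_nat_power of_nat_Suc power_Suc)
      moreover have "B * (?b - ?a) / ?a = B * (\<rho> k - 1)"
        using a by (simp add: \<rho>_def diff_divide_distrib[symmetric] right_diff_distrib diff_divide_distrib del: of_nat_power of_nat_Suc power_Suc)
      ultimately show ?thesis by (simp add: E_def add_divide_distrib)
    qed
    finally show ?thesis .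
  qed
  have "(\<lambda>k. real (Suc k) / real k) \<longlonglongrightarrow> 1" by (rule LIMSEQ_Suc_n_over_n)
  from tendsto_power[OF this, of p] have \<rho>: "\<rho> \<longlonglongrightarrow> 1"
    by (simp add: \<rho>_def[abs_def] power_divide)
  have T: "T \<longlonglongrightarrow> 0" using lim by (simp add: T_def[abs_def] D_def)
  have "E \<longlonglongrightarrow> \<bar>0\<bar> + \<bar>0\<bar> * 1 + B * (1 - 1)"
    unfolding E_def by (intro tendsto_intros T \<rho> LIMSEQ_Suc)
  then have E: "E \<longlonglongrightarrow> 0" by simp
  show ?thesis
  proof (rule LIMSEQ_I)
    fix e :: real assume "0 < e"
    then obtain K where K: "\<And>k. K \<le> k \<Longrightarrow> \<bar>E k\<bar> < e" using LIMSEQ_D[OF E] by fastforce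
    show "\<exists>N. \<forall>n\<ge>N. norm ((\<Sum>t=1..n. w t - m t) / real n - 0) < e"
    proof (intro exI allI impI)
      fix n assume n: "Suc K ^ p \<le> n"
      have "n < Suc n ^ p" using \<open>0 < p\<close> self_le_power[of "Suc n" p] by simp
      \<comment> \<open>Minimality gives \<open>k^p \<le> n < Suc k ^ p\<close>, since
        \<open>k > K\<close> has a predecessor.\<close>
      define k where "k = (LEAST j. n < Suc j ^ p)"
      have k: "n < Suc k ^ p" unfolding k_def by (rule LeastI) fact
      have "Suc K ^ p < Suc k ^ p" using n k by linarith
      then have Kk: "K < k" using power_less_imp_less_base[of "Suc K" p "Suc k"] by simp
      then obtain j where j: "k = Suc j" by (cases k) auto
      have "\<not> n < Suc j ^ p" using not_less_Least[of j "\<lambda>j. n < Suc j ^ p"] j k_def by simp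
      with k Kk j have "\<bar>D n / real n\<bar> \<le> E k" by (intro bound) auto
      with K[of k] Kk show "norm ((\<Sum>t=1..n. w t - m t) / real n - 0) < e" by (simp add: D_def)
    qed
  qed
qed

text \<open>By monotone convergence the series of the squares has finite expectation, so it
  converges almost surely and its terms tend to 0.\<close>

lemma AE_tendsto_0_of_summable_second_moments:
  fixes T :: "nat \<Rightarrow> 'a \<Rightarrow> real"
  assumes int: "\<And>k. integrable M (\<lambda>\<omega>. (T k \<omega>)\<^sup>2)"
    and bound: "\<And>k. (\<integral>\<omega>. (T k \<omega>)\<^sup>2 \<partial>M) \<le> b k" and b: "summable b"
  shows "AE \<omega> in M. (\<lambda>k. T k \<omega>) \<longlonglongrightarrow> 0"
proof -
  have [measurable]: "(\<lambda>\<omega>. (T k \<omega>)\<^sup>2) \<in> borel_measurable M" for k using int[of k] by auto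
  have b0: "0 \<le> b k" for k by (rule order_trans[OF _ bound[of k]]) (simp add: Bochner_Integration.integral_nonneg)
  have "(\<integral>\<^sup>+\<omega>. (\<Sum>k. ennreal ((T k \<omega>)\<^sup>2)) \<partial>M) = (\<Sum>k. \<integral>\<^sup>+\<omega>. ennreal ((T k \<omega>)\<^sup>2) \<partial>M)"
    by (rule nn_integral_suminf) auto
  also have "\<dots> = (\<Sum>k. ennreal (\<integral>\<omega>. (T k \<omega>)\<^sup>2 \<partial>M))"
    by (intro suminf_cong nn_integral_eq_integral int) auto
  also have "\<dots> \<le> (\<Sum>k. ennreal (b k))" by (intro suminf_le ennreal_leI bound) auto
  also have "\<dots> = ennreal (\<Sum>k. b k)" by (rule suminf_ennreal2[OF b0 b])
  also have "\<dots> < \<infinity>" by simp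
  finally have "AE \<omega> in M. (\<Sum>k. ennreal ((T k \<omega>)\<^sup>2)) \<noteq> \<infinity>"
    by (intro nn_integral_PInf_AE) auto
  then show ?thesis
  proof eventually_elim
    case (elim \<omega>)
    then have "summable (\<lambda>k. (T k \<omega>)\<^sup>2)" by (intro summable_suminf_not_top) auto
    then have "(\<lambda>k. (T k \<omega>)\<^sup>2) \<longlonglongrightarrow> 0" by (rule summable_LIMSEQ_zero)
    from tendsto_real_sqrt[OF this] have "(\<lambda>k. \<bar>T k \<omega>\<bar>) \<longlonglongrightarrow> 0" by simp
    then show ?case by (simp only: tendsto_rabs_zero_iff)
  qed
qed

text \<open>At \<open>n = k^p\<close> the average has second moment at most
  \<open>K * k powr (- p * \<beta>)\<close>. Choosing \<open>p * \<beta> \<ge> 2\<close> makes this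
  summable in \<open>k\<close>, and the interpolation lemma passes from the powers to all
  \<open>n\<close>.\<close>

lemma AE_cesaro_of_second_moment_bound:
  fixes W :: "nat \<Rightarrow> 'a \<Rightarrow> real"
  assumes W: "\<And>t \<omega>. 0 \<le> W t \<omega>" and m: "\<And>t. \<bar>m t\<bar> \<le> B" and "0 < \<beta>"
    and int: "\<And>n. integrable M (\<lambda>\<omega>. (\<Sum>t=1..n. W t \<omega> - m t)\<^sup>2)"
    and bound: "\<And>n. 1 \<le> n \<Longrightarrow> (\<integral>\<omega>. (\<Sum>t=1..n. W t \<omega> - m t)\<^sup>2 \<partial>M) \<le> K * real n powr (2 - \<beta>)"
  shows "AE \<omega> in M. (\<lambda>n. (\<Sum>t=1..n. W t \<omega> - m t) / real n) \<longlonglongrightarrow> 0"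
proof -
  obtain p :: nat where p: "2 / \<beta> < real p" using reals_Archimedean2 by blast
  have "0 < p" using p \<open>0 < \<beta>\<close> by (cases p) (auto simp: divide_less_0_iff)
  have p\<beta>: "2 \<le> real p * \<beta>" using p \<open>0 < \<beta>\<close> by (simp add: field_simps)
  define T where "T k \<omega> = (\<Sum>t=1..k^p. W t \<omega> - m t) / real (k^p)" for k \<omega>
  have K: "0 \<le> K"
  proof -
    have "0 \<le> (\<integral>\<omega>. (\<Sum>t=1..1. W t \<omega> - m t)\<^sup>2 \<partial>M)" by (intro Bochner_Integration.integral_nonneg) simp
    also have "\<dots> \<le> K" using bound[of 1] by simp
    finally show ?thesis .
  qed
  have T: "(\<integral>\<omega>. (T (Suc k) \<omega>)\<^sup>2 \<partial>M) \<le> K * (1 / real (Suc k) ^ 2)" for k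
  proof -
    let ?n = "Suc k ^ p" and ?x = "real (Suc k)"
    have n: "1 \<le> ?n" by simp
    have x: "1 \<le> ?x" by simp
    have nx: "real ?n = ?x powr real p" by (simp add: powr_realpow)
    have "(\<integral>\<omega>. (T (Suc k) \<omega>)\<^sup>2 \<partial>M) = (\<integral>\<omega>. (\<Sum>t=1..?n. W t \<omega> - m t)\<^sup>2 \<partial>M) / (real ?n)\<^sup>2"
      unfolding T_def power_divide by simp
    also have "\<dots> \<le> K * real ?n powr (2 - \<beta>) / (real ?n)\<^sup>2"
      by (intro divide_right_mono bound n) simp
    also have "\<dots> = K * (real ?n powr (2 - \<beta>) / real ?n powr 2)"
      using n by (simp add: powr_numeral del: of_nat_power of_nat_Suc power_Suc)
    also have "\<dots> = K * (?x powr (- real p * \<beta>))"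
      unfolding powr_diff[symmetric] nx powr_powr by (simp add: algebra_simps)
    also have "\<dots> \<le> K * (?x powr (-2))"
      using p\<beta> x K by (intro mult_left_mono powr_mono) auto
    also have "\<dots> = K * (1 / ?x ^ 2)"
      by (simp add: powr_minus powr_numeral divide_inverse del: of_nat_Suc)
    finally show ?thesis .
  qed
  \<comment> \<open>The shift to \<open>Suc k\<close> keeps the sample size at least 1, as the
    moment bound requires.\<close>
  have "AE \<omega> in M. (\<lambda>k. T (Suc k) \<omega>) \<longlonglongrightarrow> 0"
  proof (rule AE_tendsto_0_of_summable_second_moments[OF _ T])
    show "integrable M (\<lambda>\<omega>. (T (Suc k) \<omega>)\<^sup>2)" for k
      unfolding T_def power_divide by (intro integrable_divide_zero int)
    have "summable (\<lambda>k. 1 / real (Suc k) ^ 2)"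
      using inverse_power_summable[of 2, where 'a = real] by (subst summable_Suc_iff) (simp add: divide_inverse)
    then show "summable (\<lambda>k. K * (1 / real (Suc k) ^ 2))" by (rule summable_mult)
  qed
  then show ?thesis
  proof eventually_elim
    case (elim \<omega>)
    then have "(\<lambda>k. T k \<omega>) \<longlonglongrightarrow> 0" by (rule LIMSEQ_imp_Suc)
    then show ?case unfolding T_def by (intro cesaro_interpolation[OF W m \<open>0 < p\<close>])
  qed
qed

section \<open>Sums with polynomially decaying covariances\<close>

lemma abs_mult_le_half: "\<bar>a * b\<bar> \<le> (a\<^sup>2 + b\<^sup>2) / 2" for a b :: real
  using sum_squares_bound[of "\<bar>a\<bar>" "\<bar>b\<bar>"] by (simp add: abs_mult)

text \<open>Comparison with the integral of \<open>x powr (-\<beta>)\<close>: each term is at most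
  the increment of the antiderivative over the unit interval to its left.\<close>

lemma sum_powr_le:
  fixes \<beta> :: real
  assumes "0 < \<beta>" "\<beta> < 1"
  shows "(\<Sum>k=1..n. real k powr (-\<beta>)) \<le> real n powr (1 - \<beta>) / (1 - \<beta>)"
proof (induction n)
  case (Suc n)
  have "real (Suc n) powr (-\<beta>) \<le> (real (Suc n) powr (1 - \<beta>) - real n powr (1 - \<beta>)) / (1 - \<beta>)"
  proof (cases "n = 0")
    \<comment> \<open>The first term is treated apart because the mean value argument differentiates
      a power that is singular at 0; here the claim is
      \<open>1 \<le> 1 / (1 - \<beta>)\<close>.\<close>
    case True
    then show ?thesis using assms by (simp add: field_simps)
  next
    case False
    have "\<exists>z. real n < z \<and> z < real (Suc n) \<and> real (Suc n) powr (1 - \<beta>) - real n powr (1 - \<beta>)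
        = (real (Suc n) - real n) * ((1 - \<beta>) * z powr (1 - \<beta> - 1))"
      using False by (intro MVT2 has_real_derivative_powr) auto
    then obtain z where z: "real n < z" "z < real (Suc n)"
      "real (Suc n) powr (1 - \<beta>) - real n powr (1 - \<beta>) = (1 - \<beta>) * z powr (-\<beta>)"
      by auto
    have "real (Suc n) powr (-\<beta>) \<le> z powr (-\<beta>)"
      using z assms by (intro powr_mono2') auto
    then show ?thesis using assms unfolding z(3) by simp
  qed
  then show ?case using Suc by (simp add: diff_divide_distrib)
qed simp

text \<open>Distinct exponents make the sum a subsum of the geometric series.\<close>

lemma sum_power_inj_le:
  fixes x :: real
  assumes "0 \<le> x" "x < 1" "finite A" "inj_on h A"
  shows "(\<Sum>t\<in>A. x ^ h t) \<le> 1 / (1 - x)"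
proof -
  have "(\<Sum>t\<in>A. x ^ h t) = (\<Sum>k\<in>h ` A. x ^ k)"
    using assms by (simp add: sum.reindex)
  also have "\<dots> \<le> (\<Sum>k. x ^ k)"
    using assms by (intro sum_le_suminf summable_geometric) auto
  also have "\<dots> = 1 / (1 - x)" using assms by (intro suminf_geometric) auto
  finally show ?thesis .
qed

text \<open>Serves both levels of the double series for \<open>f\<close>; with \<open>N = 0\<close>
  it bounds a whole inner series.\<close>

lemma geometric_tail:
  fixes g :: "nat \<Rightarrow> real"
  assumes "0 \<le> x" "x < 1" and g: "\<And>j. \<bar>g j\<bar> \<le> c * x ^ j"
  shows "\<bar>suminf g - (\<Sum>j<N. g j)\<bar> \<le> c * x ^ N / (1 - x)"
proof -
  have s: "summable (\<lambda>j. c * x ^ (j + N))" for N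
    using assms by (simp add: power_add summable_mult summable_mult2 summable_geometric)
  have "summable g"
    by (rule summable_comparison_test'[OF s[of 0], of 0]) (use g in auto)
  have sN: "summable (\<lambda>j. \<bar>g (j + N)\<bar>)"
    by (rule summable_comparison_test'[OF s[of N], of 0]) (use g in auto)
  have "suminf g - (\<Sum>j<N. g j) = (\<Sum>j. g (j + N))"
    using suminf_split_initial_segment[OF \<open>summable g\<close>, of N] by simp
  also have "\<bar>\<dots>\<bar> \<le> (\<Sum>j. \<bar>g (j + N)\<bar>)" by (rule summable_rabs[OF sN])
  also have "\<dots> \<le> (\<Sum>j. c * x ^ (j + N))" by (intro suminf_le g sN s)
  also have "\<dots> = (\<Sum>j. (c * x ^ N) * x ^ j)" by (simp add: power_add mult_ac)
  also have "\<dots> = c * x ^ N / (1 - x)"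
    using assms by (subst suminf_mult) (auto simp: suminf_geometric summable_geometric)
  finally show ?thesis .
qed

lemma integral_square_sum:
  fixes f :: "'i \<Rightarrow> 'a \<Rightarrow> real"
  assumes "\<And>s t. s \<in> A \<Longrightarrow> t \<in> A \<Longrightarrow> integrable M (\<lambda>\<omega>. f s \<omega> * f t \<omega>)"
  shows "integrable M (\<lambda>\<omega>. (\<Sum>t\<in>A. f t \<omega>)\<^sup>2)"
    and "(\<integral>\<omega>. (\<Sum>t\<in>A. f t \<omega>)\<^sup>2 \<partial>M) = (\<Sum>s\<in>A. \<Sum>t\<in>A. \<integral>\<omega>. f s \<omega> * f t \<omega> \<partial>M)"
proof -
  have eq: "(\<lambda>\<omega>. (\<Sum>t\<in>A. f t \<omega>)\<^sup>2) = (\<lambda>\<omega>. \<Sum>s\<in>A. \<Sum>t\<in>A. f s \<omega> * f t \<omega>)"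
    by (simp add: power2_eq_square sum_product)
  show "integrable M (\<lambda>\<omega>. (\<Sum>t\<in>A. f t \<omega>)\<^sup>2)"
    unfolding eq by (intro Bochner_Integration.integrable_sum assms)
  show "(\<integral>\<omega>. (\<Sum>t\<in>A. f t \<omega>)\<^sup>2 \<partial>M) = (\<Sum>s\<in>A. \<Sum>t\<in>A. \<integral>\<omega>. f s \<omega> * f t \<omega> \<partial>M)"
    unfolding eq using assms
    by (subst Bochner_Integration.integral_sum, force)
       (intro sum.cong refl Bochner_Integration.integral_sum, force)
qed

text \<open>In each row, every nonzero lag occurs at most once on either side of the
  diagonal.\<close>

lemma sum_toeplitz_le:
  fixes r :: "int \<Rightarrow> real"
  assumes r: "\<And>k. 0 \<le> r k" and sym: "\<And>k. r (- k) = r k"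
  shows "(\<Sum>a=1..n. \<Sum>b=1..n. r (int b - int a)) \<le> real n * (r 0 + 2 * (\<Sum>k=1..n. r (int k)))"
proof -
  have "(\<Sum>b=1..n. r (int b - int a)) \<le> r 0 + 2 * (\<Sum>k=1..n. r (int k))" if a: "a \<in> {1..n}" for a
  proof -
    have "{1..n} = {1..<a} \<union> ({a} \<union> {a<..n})" using a by auto
    then have "(\<Sum>b=1..n. r (int b - int a))
        = (\<Sum>b\<in>{1..<a}. r (int b - int a)) + (r 0 + (\<Sum>b\<in>{a<..n}. r (int b - int a)))"
      by (subst \<open>{1..n} = _\<close>) (subst sum.union_disjoint; auto)
    also have "(\<Sum>b\<in>{1..<a}. r (int b - int a)) = (\<Sum>k\<in>(\<lambda>b. a - b) ` {1..<a}. r (int k))"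
    proof -
      have "r (int b - int a) = r (int (a - b))" if "b \<in> {1..<a}" for b
        using that sym[of "int a - int b"] by (simp add: of_nat_diff)
      then show ?thesis by (subst sum.reindex) (auto simp: inj_on_def intro!: sum.cong)
    qed
    also have "\<dots> \<le> (\<Sum>k=1..n. r (int k))" using a r by (intro sum_mono2) auto
    also have "(\<Sum>b\<in>{a<..n}. r (int b - int a)) = (\<Sum>k\<in>(\<lambda>b. b - a) ` {a<..n}. r (int k))"
      by (subst sum.reindex) (auto simp: inj_on_def of_nat_diff intro!: sum.cong)
    also have "\<dots> \<le> (\<Sum>k=1..n. r (int k))" using a r by (intro sum_mono2) auto
    finally show ?thesis by simp
  qed
  then have "(\<Sum>a=1..n. \<Sum>b=1..n. r (int b - int a)) \<le> (\<Sum>a=1..n. r 0 + 2 * (\<Sum>k=1..n. r (int k)))"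
    by (intro sum_mono)
  then show ?thesis by simp
qed

section \<open>Filtered stationary Gaussian noise\<close>

locale stationary_gaussian_noise = prob_space M for M :: "'a measure" +
  fixes \<xi> :: "int \<Rightarrow> 'a \<Rightarrow> real"
  assumes gaussian: "gaussian_process M \<xi>" and centered: "zero_mean M \<xi>"
    and stationary: "stationary M \<xi>"
begin

abbreviation R :: "int \<Rightarrow> real" where "R \<equiv> autocov M \<xi>"

lemma measurable_noise[measurable]: "\<xi> s \<in> borel_measurable M"
  using stationary by (simp add: stationary_def)

lemma integrable_noise_square: "integrable M (\<lambda>\<omega>. (\<xi> s \<omega>)\<^sup>2)"
proof -
  have "gaussian_rv M (\<xi> s)"
    using gaussian[unfolded gaussian_process_def, rule_format, of "{s}" "\<lambda>_. 1"] by simp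
  then show ?thesis by (rule gaussian_rv_integrable_square[OF prob_space_axioms])
qed

lemma integrable_noise_product: "integrable M (\<lambda>\<omega>. \<xi> s \<omega> * \<xi> t \<omega>)"
proof (rule Bochner_Integration.integrable_bound)
  show "integrable M (\<lambda>\<omega>. ((\<xi> s \<omega>)\<^sup>2 + (\<xi> t \<omega>)\<^sup>2) / 2)"
    by (intro integrable_divide_zero Bochner_Integration.integrable_add integrable_noise_square)
  show "AE \<omega> in M. norm (\<xi> s \<omega> * \<xi> t \<omega>) \<le> norm (((\<xi> s \<omega>)\<^sup>2 + (\<xi> t \<omega>)\<^sup>2) / 2)"
    using abs_mult_le_half by (intro AE_I2) simp
qed measurable

lemma autocov_minus: "R (- k) = R k"
  using stationary_autocov[OF stationary, of 0 k] stationary_autocov[OF stationary, of k 0]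
  by (simp add: mult.commute)

text \<open>Both variables have second moment \<open>R 0\<close> by stationarity, so the
  arithmetic-geometric inequality does the work of Cauchy-Schwarz.\<close>

lemma abs_autocov_le: "\<bar>R k\<bar> \<le> R 0"
proof -
  have sq: "(\<integral>\<omega>. (\<xi> s \<omega>)\<^sup>2 \<partial>M) = R 0" for s
    using stationary_autocov[OF stationary, of s s] by (simp add: power2_eq_square)
  have "\<bar>R k\<bar> \<le> (\<integral>\<omega>. \<bar>\<xi> 0 \<omega> * \<xi> k \<omega>\<bar> \<partial>M)"
    unfolding autocov_def by (rule integral_abs_bound)
  also have "\<dots> \<le> (\<integral>\<omega>. ((\<xi> 0 \<omega>)\<^sup>2 + (\<xi> k \<omega>)\<^sup>2) / 2 \<partial>M)"
    by (intro integral_mono integrable_abs integrable_noise_product integrable_divide_zero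
        Bochner_Integration.integrable_add integrable_noise_square abs_mult_le_half)
  also have "\<dots> = R 0" by (simp add: integrable_noise_square sq)
  finally show ?thesis .
qed

lemma gaussian_combination:
  fixes c :: "nat \<Rightarrow> real"
  assumes "finite J"
  shows "gaussian_rv M (\<lambda>\<omega>. \<Sum>a\<in>J. c a * \<xi> (int a) \<omega>)"
  using gaussian[unfolded gaussian_process_def, rule_format, of "int ` J" "\<lambda>i. c (nat i)"] assms
  by (simp add: sum.reindex)

lemma mean_combination:
  fixes c :: "nat \<Rightarrow> real"
  shows "(\<integral>\<omega>. (\<Sum>a\<in>J. c a * \<xi> (int a) \<omega>) \<partial>M) = 0"
  using centered by (simp add: zero_mean_def Bochner_Integration.integral_sum)

lemma product_combination:
  fixes c d :: "nat \<Rightarrow> real"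
  shows "integrable M (\<lambda>\<omega>. (\<Sum>a\<in>J. c a * \<xi> (int a) \<omega>) * (\<Sum>b\<in>J. d b * \<xi> (int b) \<omega>))"
    and "(\<integral>\<omega>. (\<Sum>a\<in>J. c a * \<xi> (int a) \<omega>) * (\<Sum>b\<in>J. d b * \<xi> (int b) \<omega>) \<partial>M)
      = (\<Sum>a\<in>J. \<Sum>b\<in>J. c a * d b * R (int b - int a))"
proof -
  have eq: "(\<lambda>\<omega>. (\<Sum>a\<in>J. c a * \<xi> (int a) \<omega>) * (\<Sum>b\<in>J. d b * \<xi> (int b) \<omega>))
      = (\<lambda>\<omega>. \<Sum>a\<in>J. \<Sum>b\<in>J. c a * d b * (\<xi> (int a) \<omega> * \<xi> (int b) \<omega>))"
    by (simp add: sum_product mult_ac)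
  have i: "integrable M (\<lambda>\<omega>. c a * d b * (\<xi> (int a) \<omega> * \<xi> (int b) \<omega>))" for a b
    by (intro integrable_mult_right integrable_noise_product)
  show "integrable M (\<lambda>\<omega>. (\<Sum>a\<in>J. c a * \<xi> (int a) \<omega>) * (\<Sum>b\<in>J. d b * \<xi> (int b) \<omega>))"
    unfolding eq by (intro Bochner_Integration.integrable_sum i)
  show "(\<integral>\<omega>. (\<Sum>a\<in>J. c a * \<xi> (int a) \<omega>) * (\<Sum>b\<in>J. d b * \<xi> (int b) \<omega>) \<partial>M)
      = (\<Sum>a\<in>J. \<Sum>b\<in>J. c a * d b * R (int b - int a))"
    unfolding eq stationary_autocov[OF stationary, symmetric] integral_mult_right_zero[symmetric]
    by (subst Bochner_Integration.integral_sum, intro Bochner_Integration.integrable_sum i)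
       (intro sum.cong refl Bochner_Integration.integral_sum i)
qed

section \<open>Truncation of the double series and continuity of the second moment\<close>

text \<open>Cutting the inner series in the rows \<open>i < N\<close> and dropping the rows
  \<open>i \<ge> N\<close> each cost at most \<open>R 0 * x ^ N / (1 - x)\<^sup>2\<close>, whence
  the factor 2.\<close>

lemma second_moment_approx:
  assumes "0 < x" "x < 1"
  shows "\<bar>second_moment M \<xi> x - (\<Sum>i<N. \<Sum>j<N. x ^ (i + j) * R (int i - int j))\<bar>
    \<le> 2 * R 0 * x ^ N / (1 - x)\<^sup>2"
proof -
  define h where "h i j = x ^ (i + j) * R (int i - int j)" for i j
  have x: "0 \<le> x" "x < 1" using assms by auto
  have h: "\<bar>h i j\<bar> \<le> (R 0 * x ^ i) * x ^ j" for i j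
    using mult_right_mono[OF abs_autocov_le[of "int i - int j"], of "x ^ (i + j)"] x
    by (simp add: h_def abs_mult power_add mult_ac)
  note tail = geometric_tail[OF x h]
  have s: "\<bar>suminf (h i)\<bar> \<le> (R 0 / (1 - x)) * x ^ i" for i
    using tail[of i 0] by simp
  have f: "second_moment M \<xi> x = (\<Sum>i. suminf (h i))"
    unfolding second_moment_def h_def
    by (rule second_moment_series(2)[OF prob_space_axioms gaussian stationary assms])
  have "\<bar>(\<Sum>i<N. suminf (h i)) - (\<Sum>i<N. \<Sum>j<N. h i j)\<bar> \<le> (\<Sum>i<N. \<bar>suminf (h i) - (\<Sum>j<N. h i j)\<bar>)"
    unfolding sum_subtractf[symmetric] by (rule sum_abs)
  also have "\<dots> \<le> (\<Sum>i<N. (R 0 * x ^ i) * x ^ N / (1 - x))" by (intro sum_mono tail)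
  also have "\<dots> = (R 0 * x ^ N / (1 - x)) * (\<Sum>i<N. x ^ i)"
    by (simp add: sum_distrib_left sum_divide_distrib mult_ac)
  also have "\<dots> \<le> (R 0 * x ^ N / (1 - x)) * (1 / (1 - x))"
    using x abs_autocov_le[of 0] by (intro mult_left_mono sum_power_inj_le) auto
  finally have "\<bar>(\<Sum>i<N. suminf (h i)) - (\<Sum>i<N. \<Sum>j<N. h i j)\<bar> \<le> R 0 * x ^ N / (1 - x)\<^sup>2"
    by (simp add: power2_eq_square)
  moreover have "\<bar>(\<Sum>i. suminf (h i)) - (\<Sum>i<N. suminf (h i))\<bar> \<le> R 0 * x ^ N / (1 - x)\<^sup>2"
    using geometric_tail[OF x s, of N] by (simp add: power2_eq_square)
  ultimately show ?thesis unfolding f h_def[symmetric] by (simp add: add_divide_distrib[symmetric])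
qed

text \<open>The square truncations are polynomials in \<open>y\<close>. Their error is increasing in
  \<open>y\<close> but blows up at 1, so uniform convergence is obtained on an interval ending at
  some \<open>r\<close> strictly between \<open>x\<close> and 1.\<close>

lemma isCont_second_moment:
  assumes "0 < x" "x < 1"
  shows "isCont (second_moment M \<xi>) x"
proof -
  define r where "r = (x + 1) / 2"
  have r: "x < r" "r < 1" using assms by (auto simp: r_def)
  have "uniform_limit {0<..<r} (\<lambda>N y. \<Sum>i<N. \<Sum>j<N. y ^ (i + j) * R (int i - int j))
      (second_moment M \<xi>) sequentially"
  proof (rule uniform_limitI)
    fix e :: real assume "0 < e"
    have "(\<lambda>N. 2 * R 0 * r ^ N / (1 - r)\<^sup>2) \<longlonglongrightarrow> 2 * R 0 * 0 / (1 - r)\<^sup>2"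
      using r assms by (intro tendsto_intros LIMSEQ_realpow_zero) auto
    then have "\<forall>\<^sub>F N in sequentially. 2 * R 0 * r ^ N / (1 - r)\<^sup>2 < e"
      using \<open>0 < e\<close> by (intro order_tendstoD(2)) auto
    then show "\<forall>\<^sub>F N in sequentially. \<forall>y\<in>{0<..<r}.
        dist (\<Sum>i<N. \<Sum>j<N. y ^ (i + j) * R (int i - int j)) (second_moment M \<xi> y) < e"
    proof eventually_elim
      case (elim N)
      have "dist (\<Sum>i<N. \<Sum>j<N. y ^ (i + j) * R (int i - int j)) (second_moment M \<xi> y) < e"
        if y: "y \<in> {0<..<r}" for y
      proof -
        have "\<bar>second_moment M \<xi> y - (\<Sum>i<N. \<Sum>j<N. y ^ (i + j) * R (int i - int j))\<bar>
            \<le> 2 * R 0 * y ^ N / (1 - y)\<^sup>2"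
          using y r by (intro second_moment_approx) auto
        also have "\<dots> \<le> 2 * R 0 * r ^ N / (1 - r)\<^sup>2"
          using y r abs_autocov_le[of 0] by (intro frac_le mult_left_mono power_mono) auto
        also note elim
        finally show ?thesis by (simp add: dist_real_def abs_minus_commute)
      qed
      then show ?case by blast
    qed
  qed
  then have "continuous_on {0<..<r} (second_moment M \<xi>)"
    by (rule uniform_limit_theorem[rotated]) (auto intro!: always_eventually continuous_intros)
  then show ?thesis using assms r by (simp add: continuous_on_eq_continuous_at)
qed

section \<open>The filtered noise and its covariances\<close>

text \<open>The autoregression driven by the noise alone and started from 0, in closed form.\<close>

definition filtered :: "real \<Rightarrow> nat \<Rightarrow> 'a \<Rightarrow> real" where
  "filtered \<theta> t \<omega> = (\<Sum>a=1..t. \<theta> ^ (t - a) * \<xi> (int a) \<omega>)"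

text \<open>Extension by 0 lets several times share one index range \<open>{1..n}\<close>. The guard
  matters: for \<open>a > t\<close> natural subtraction would give exponent 0 and weight 1.\<close>

definition filter_weight :: "real \<Rightarrow> nat \<Rightarrow> nat \<Rightarrow> real" where
  "filter_weight \<theta> t a = (if a \<le> t then \<theta> ^ (t - a) else 0)"

definition filtered_cov :: "real \<Rightarrow> nat \<Rightarrow> nat \<Rightarrow> real" where
  "filtered_cov \<theta> s t = (\<integral>\<omega>. filtered \<theta> s \<omega> * filtered \<theta> t \<omega> \<partial>M)"

lemma filtered_eq_weighted_sum:
  assumes "t \<le> n"
  shows "filtered \<theta> t = (\<lambda>\<omega>. \<Sum>a=1..n. filter_weight \<theta> t a * \<xi> (int a) \<omega>)"
proof
  fix \<omega>
  show "filtered \<theta> t \<omega> = (\<Sum>a=1..n. filter_weight \<theta> t a * \<xi> (int a) \<omega>)"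
    unfolding filtered_def filter_weight_def using assms
    by (intro sum.mono_neutral_cong_left) auto
qed

lemma filtered_Suc: "filtered \<theta> (Suc t) \<omega> = \<theta> * filtered \<theta> t \<omega> + \<xi> (int (Suc t)) \<omega>"
  by (simp add: filtered_def sum_distrib_left Suc_diff_le mult.assoc)

lemma integrable_filtered_product: "integrable M (\<lambda>\<omega>. filtered \<theta> s \<omega> * filtered \<theta> t \<omega>)"
proof -
  define n where "n = max s t"
  have "s \<le> n" "t \<le> n" by (auto simp: n_def)
  note eq = this[THEN filtered_eq_weighted_sum]
  show ?thesis unfolding eq by (rule product_combination)
qed

lemma measurable_filtered[measurable]: "filtered \<theta> t \<in> borel_measurable M"
  unfolding filtered_eq_weighted_sum[OF order_refl] by measurable

text \<open>Summing over the time \<open>t\<close> serves the double sum of covariances; summing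
  over the noise index \<open>a\<close> serves the uniform bound on a single covariance.\<close>

lemma filter_weight_sums:
  assumes "0 < \<theta>" "\<theta> < 1"
  shows "0 \<le> filter_weight \<theta> t a"
    and "(\<Sum>t=1..n. filter_weight \<theta> t a) \<le> 1 / (1 - \<theta>)"
    and "(\<Sum>a=1..n. filter_weight \<theta> t a) \<le> 1 / (1 - \<theta>)"
proof -
  show "0 \<le> filter_weight \<theta> t a" using assms by (simp add: filter_weight_def)
  have "(\<Sum>t=1..n. filter_weight \<theta> t a) = (\<Sum>t\<in>{t\<in>{1..n}. a \<le> t}. \<theta> ^ (t - a))"
    unfolding filter_weight_def by (intro sum.mono_neutral_cong_right) auto
  also have "\<dots> \<le> 1 / (1 - \<theta>)"
    using assms by (intro sum_power_inj_le) (auto simp: inj_on_def)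
  finally show "(\<Sum>t=1..n. filter_weight \<theta> t a) \<le> 1 / (1 - \<theta>)" .
  have "(\<Sum>a=1..n. filter_weight \<theta> t a) = (\<Sum>a\<in>{a\<in>{1..n}. a \<le> t}. \<theta> ^ (t - a))"
    unfolding filter_weight_def by (intro sum.mono_neutral_cong_right) auto
  also have "\<dots> \<le> 1 / (1 - \<theta>)"
    using assms by (intro sum_power_inj_le) (auto simp: inj_on_def)
  finally show "(\<Sum>a=1..n. filter_weight \<theta> t a) \<le> 1 / (1 - \<theta>)" .
qed

lemma abs_filtered_cov_le:
  assumes "0 < \<theta>" "\<theta> < 1" "s \<le> n" "t \<le> n"
  shows "\<bar>filtered_cov \<theta> s t\<bar>
    \<le> (\<Sum>a=1..n. \<Sum>b=1..n. filter_weight \<theta> s a * filter_weight \<theta> t b * \<bar>R (int b - int a)\<bar>)"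
proof -
  have "filtered_cov \<theta> s t
      = (\<Sum>a=1..n. \<Sum>b=1..n. filter_weight \<theta> s a * filter_weight \<theta> t b * R (int b - int a))"
    unfolding filtered_cov_def filtered_eq_weighted_sum[OF assms(3)] filtered_eq_weighted_sum[OF assms(4)]
    by (rule product_combination)
  then show ?thesis
    by (simp only:) (intro order_trans[OF sum_abs] sum_mono,
      auto simp: abs_mult filter_weight_sums(1)[OF assms(1,2)])
qed

lemma abs_filtered_cov_le_const:
  assumes "0 < \<theta>" "\<theta> < 1"
  shows "\<bar>filtered_cov \<theta> s t\<bar> \<le> R 0 / (1 - \<theta>)\<^sup>2"
proof -
  define n where "n = max s t"
  note w = filter_weight_sums[OF assms]
  have R0: "0 \<le> R 0" using abs_autocov_le[of 0] by linarith
  have "\<bar>filtered_cov \<theta> s t\<bar>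
      \<le> (\<Sum>a=1..n. \<Sum>b=1..n. filter_weight \<theta> s a * filter_weight \<theta> t b * \<bar>R (int b - int a)\<bar>)"
    by (rule abs_filtered_cov_le[OF assms]) (auto simp: n_def)
  also have "\<dots> \<le> (\<Sum>a=1..n. \<Sum>b=1..n. filter_weight \<theta> s a * filter_weight \<theta> t b * R 0)"
    by (intro sum_mono mult_left_mono abs_autocov_le mult_nonneg_nonneg w)
  also have "\<dots> = (\<Sum>a=1..n. filter_weight \<theta> s a) * (\<Sum>b=1..n. filter_weight \<theta> t b) * R 0"
    by (subst sum_product) (simp only: sum_distrib_right)
  also have "\<dots> \<le> 1 / (1 - \<theta>) * (1 / (1 - \<theta>)) * R 0"
    using assms by (intro mult_right_mono mult_mono w sum_nonneg R0) auto
  finally show ?thesis by (simp add: power2_eq_square)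
qed

text \<open>Filtering does not change the order of growth: summing over the times first leaves at
  most \<open>L\<^sup>2\<close> times the double sum of \<open>\<bar>R (b - a)\<bar>\<close>. That
  has \<open>n\<close> rows, each of order \<open>n powr (1 - \<beta>)\<close>.\<close>

lemma sum_abs_filtered_cov_le:
  assumes \<theta>: "0 < \<theta>" "\<theta> < 1" and \<beta>: "0 < \<beta>" "\<beta> < 1"
    and decay: "\<And>k. 1 \<le> k \<Longrightarrow> \<bar>R (int k)\<bar> \<le> A * real k powr (- \<beta>)"
  obtains K where "0 \<le> K"
    "\<And>n. 1 \<le> n \<Longrightarrow> (\<Sum>s=1..n. \<Sum>t=1..n. \<bar>filtered_cov \<theta> s t\<bar>) \<le> K * real n powr (2 - \<beta>)"
proof
  define L where "L = 1 / (1 - \<theta>)"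
  have L: "0 \<le> L" using \<theta> by (simp add: L_def)
  have A: "0 \<le> A" using decay[of 1] by simp
  have R0: "0 \<le> R 0" using abs_autocov_le[of 0] by linarith
  note w = filter_weight_sums[OF \<theta>]
  let ?K = "L\<^sup>2 * (R 0 + 2 * (A / (1 - \<beta>)))"
  show "0 \<le> ?K" using A R0 \<beta> by simp
  fix n :: nat assume n: "1 \<le> n"
  let ?N = "{1..n}" and ?w = "filter_weight \<theta>"
  have "(\<Sum>s\<in>?N. \<Sum>t\<in>?N. \<bar>filtered_cov \<theta> s t\<bar>)
      \<le> (\<Sum>s\<in>?N. \<Sum>t\<in>?N. \<Sum>a\<in>?N. \<Sum>b\<in>?N. ?w s a * ?w t b * \<bar>R (int b - int a)\<bar>)"
    by (intro sum_mono abs_filtered_cov_le \<theta>) auto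
  \<comment> \<open>The next interchanges move the times \<open>s\<close> and \<open>t\<close>
    innermost, where each factor depends on only one of them.\<close>
  also have "\<dots> = (\<Sum>s\<in>?N. \<Sum>a\<in>?N. \<Sum>t\<in>?N. \<Sum>b\<in>?N. ?w s a * ?w t b * \<bar>R (int b - int a)\<bar>)"
    by (intro sum.cong refl sum.swap)
  also have "\<dots> = (\<Sum>a\<in>?N. \<Sum>s\<in>?N. \<Sum>b\<in>?N. \<Sum>t\<in>?N. ?w s a * ?w t b * \<bar>R (int b - int a)\<bar>)"
    by (subst sum.swap) (intro sum.cong refl sum.swap)
  also have "\<dots> = (\<Sum>a\<in>?N. \<Sum>b\<in>?N. \<Sum>s\<in>?N. \<Sum>t\<in>?N. ?w s a * ?w t b * \<bar>R (int b - int a)\<bar>)"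
    by (intro sum.cong refl sum.swap)
  also have "\<dots> = (\<Sum>a\<in>?N. \<Sum>b\<in>?N. (\<Sum>s\<in>?N. ?w s a) * (\<Sum>t\<in>?N. ?w t b) * \<bar>R (int b - int a)\<bar>)"
    by (intro sum.cong refl) (subst sum_product, simp only: sum_distrib_right)
  also have "\<dots> \<le> (\<Sum>a\<in>?N. \<Sum>b\<in>?N. L * L * \<bar>R (int b - int a)\<bar>)"
    using L by (intro sum_mono mult_right_mono mult_mono sum_nonneg w[folded L_def]) auto
  also have "\<dots> = L\<^sup>2 * (\<Sum>a\<in>?N. \<Sum>b\<in>?N. \<bar>R (int b - int a)\<bar>)"
    by (simp add: sum_distrib_left power2_eq_square)
  also have "\<dots> \<le> L\<^sup>2 * (real n * (\<bar>R 0\<bar> + 2 * (\<Sum>k\<in>?N. \<bar>R (int k)\<bar>)))"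
    by (intro mult_left_mono sum_toeplitz_le) (auto simp: autocov_minus)
  also have "\<dots> \<le> L\<^sup>2 * (real n * (R 0 * real n powr (1 - \<beta>) + 2 * (A * (real n powr (1 - \<beta>) / (1 - \<beta>)))))"
  proof -
    have "(\<Sum>k\<in>?N. \<bar>R (int k)\<bar>) \<le> (\<Sum>k\<in>?N. A * real k powr (- \<beta>))"
      by (intro sum_mono decay) auto
    also have "\<dots> \<le> A * (real n powr (1 - \<beta>) / (1 - \<beta>))"
      unfolding sum_distrib_left[symmetric] by (intro mult_left_mono sum_powr_le \<beta> A)
    finally have "(\<Sum>k\<in>?N. \<bar>R (int k)\<bar>) \<le> A * (real n powr (1 - \<beta>) / (1 - \<beta>))" .
    \<comment> \<open>The diagonal term is absorbed into the same power, using
      \<open>1 \<le> n powr (1 - \<beta>)\<close>.\<close>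
    moreover have "R 0 * 1 \<le> R 0 * real n powr (1 - \<beta>)"
      using n \<beta> R0 by (intro mult_left_mono ge_one_powr_ge_zero) auto
    ultimately show ?thesis using R0 by (intro mult_left_mono) auto
  qed
  also have "\<dots> = ?K * (real n powr 1 * real n powr (1 - \<beta>))"
    using n by (simp add: algebra_simps add_divide_distrib)
  also have "\<dots> = ?K * real n powr (2 - \<beta>)"
    unfolding powr_add[symmetric] by simp
  finally show "(\<Sum>s=1..n. \<Sum>t=1..n. \<bar>filtered_cov \<theta> s t\<bar>) \<le> ?K * real n powr (2 - \<beta>)" .
qed

text \<open>Counting lags backwards from \<open>t\<close> turns the variance at time
  \<open>t\<close> into exactly the \<open>t\<close> by \<open>t\<close> truncation of the double
  series, so the truncation bound applies with \<open>N = t\<close>.\<close>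

lemma filtered_cov_diagonal_LIMSEQ:
  assumes "0 < \<theta>" "\<theta> < 1"
  shows "(\<lambda>t. filtered_cov \<theta> t t) \<longlonglongrightarrow> second_moment M \<xi> \<theta>"
proof -
  have rev: "(\<Sum>a=1..t. h a) = (\<Sum>i<t. h (t - i))" for h :: "nat \<Rightarrow> real" and t
  proof -
    have "(\<Sum>a=1..t. h a) = (\<Sum>i<t. h (Suc i))"
      using sum.atLeast1_atMost_eq[of h t] by simp
    also have "\<dots> = (\<Sum>i<t. h (Suc (t - Suc i)))"
      by (rule sum.nat_diff_reindex[symmetric])
    also have "\<dots> = (\<Sum>i<t. h (t - i))"
      by (intro sum.cong) (auto simp: Suc_diff_Suc)
    finally show ?thesis .
  qed
  have eq: "filtered_cov \<theta> t t = (\<Sum>i<t. \<Sum>j<t. \<theta> ^ (i + j) * R (int i - int j))" for t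
  proof -
    have "filtered_cov \<theta> t t
        = (\<Sum>a=1..t. \<Sum>b=1..t. \<theta> ^ (t - a) * \<theta> ^ (t - b) * R (int b - int a))"
      unfolding filtered_cov_def filtered_def by (rule product_combination)
    also have "\<dots> = (\<Sum>i<t. \<Sum>j<t. \<theta> ^ (t - (t - i)) * \<theta> ^ (t - (t - j)) * R (int (t - j) - int (t - i)))"
      by (simp only: rev[of _ t])
    also have "\<dots> = (\<Sum>i<t. \<Sum>j<t. \<theta> ^ (i + j) * R (int i - int j))"
      by (intro sum.cong) (auto simp: power_add of_nat_diff)
    finally show ?thesis .
  qed
  have lim: "(\<lambda>t. 2 * R 0 * \<theta> ^ t / (1 - \<theta>)\<^sup>2) \<longlonglongrightarrow> 2 * R 0 * 0 / (1 - \<theta>)\<^sup>2"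
    using assms by (intro tendsto_intros LIMSEQ_realpow_zero) auto
  have "\<bar>filtered_cov \<theta> t t - second_moment M \<xi> \<theta>\<bar> \<le> 2 * R 0 * \<theta> ^ t / (1 - \<theta>)\<^sup>2" for t
    using second_moment_approx[OF assms, of t] unfolding eq by (simp only: abs_minus_commute)
  then have "(\<lambda>t. filtered_cov \<theta> t t - second_moment M \<xi> \<theta>) \<longlonglongrightarrow> 0"
    unfolding real_norm_def[symmetric] using lim[unfolded mult_zero_right div_0]
    by (rule Lim_null_comparison[OF always_eventually[OF allI]])
  then show ?thesis by (rule LIM_zero_cancel)
qed

section \<open>Laws of large numbers for the filtered noise and its squares\<close>

lemma filtered_square_product:
  shows "integrable M (\<lambda>\<omega>. (filtered \<theta> s \<omega>)\<^sup>2 * (filtered \<theta> t \<omega>)\<^sup>2)"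
    and "(\<integral>\<omega>. (filtered \<theta> s \<omega>)\<^sup>2 * (filtered \<theta> t \<omega>)\<^sup>2 \<partial>M)
      = filtered_cov \<theta> s s * filtered_cov \<theta> t t + 2 * (filtered_cov \<theta> s t)\<^sup>2"
proof -
  define n where "n = max s t"
  have st: "s \<le> n" "t \<le> n" by (auto simp: n_def)
  note eq = filtered_eq_weighted_sum[OF st(1)] filtered_eq_weighted_sum[OF st(2)]
  have lin: "a * filtered \<theta> s \<omega> + b * filtered \<theta> t \<omega>
      = (\<Sum>i=1..n. (a * filter_weight \<theta> s i + b * filter_weight \<theta> t i) * \<xi> (int i) \<omega>)" for a b \<omega>
    unfolding eq by (simp add: sum_distrib_left sum.distrib algebra_simps)
  have g: "gaussian_rv M (\<lambda>\<omega>. a * filtered \<theta> s \<omega> + b * filtered \<theta> t \<omega>)" for a b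
    unfolding lin by (rule gaussian_combination) simp
  have m: "(\<integral>\<omega>. filtered \<theta> s \<omega> \<partial>M) = 0" "(\<integral>\<omega>. filtered \<theta> t \<omega> \<partial>M) = 0"
    unfolding filtered_def by (rule mean_combination)+
  note * = gaussian_square_product_moment[OF prob_space_axioms g m]
  show "integrable M (\<lambda>\<omega>. (filtered \<theta> s \<omega>)\<^sup>2 * (filtered \<theta> t \<omega>)\<^sup>2)" by (rule *)
  show "(\<integral>\<omega>. (filtered \<theta> s \<omega>)\<^sup>2 * (filtered \<theta> t \<omega>)\<^sup>2 \<partial>M)
      = filtered_cov \<theta> s s * filtered_cov \<theta> t t + 2 * (filtered_cov \<theta> s t)\<^sup>2"
    using *(2) by (simp add: filtered_cov_def power2_eq_square)
qed

text \<open>The second moments of the centred sums of \<open>Z\<close> and of its squares are both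
  controlled by the double sum of absolute covariances, hence of order
  \<open>n powr (2 - \<beta>)\<close>.\<close>

lemma AE_cesaro_filtered:
  assumes \<theta>: "0 < \<theta>" "\<theta> < 1" and \<beta>: "0 < \<beta>" "\<beta> < 1"
    and decay: "\<And>k. 1 \<le> k \<Longrightarrow> \<bar>R (int k)\<bar> \<le> A * real k powr (- \<beta>)"
  shows "AE \<omega> in M. (\<lambda>n. (\<Sum>t=1..n. (filtered \<theta> t \<omega>)\<^sup>2 - filtered_cov \<theta> t t) / real n) \<longlonglongrightarrow> 0"
    and "AE \<omega> in M. (\<lambda>n. (\<Sum>t=1..n. filtered \<theta> t \<omega>) / real n) \<longlonglongrightarrow> 0"
proof -
  obtain K where K: "0 \<le> K"
    "\<And>n. 1 \<le> n \<Longrightarrow> (\<Sum>s=1..n. \<Sum>t=1..n. \<bar>filtered_cov \<theta> s t\<bar>) \<le> K * real n powr (2 - \<beta>)"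
    using sum_abs_filtered_cov_le[OF \<theta> \<beta> decay] by blast
  define B where "B = R 0 / (1 - \<theta>)\<^sup>2"
  have cB: "\<bar>filtered_cov \<theta> s t\<bar> \<le> B" for s t
    unfolding B_def by (rule abs_filtered_cov_le_const[OF \<theta>])
  define v where "v t = filtered_cov \<theta> t t" for t
  let ?Z = "filtered \<theta>"
  define P where "P n \<omega> = (\<Sum>t=1..n. (?Z t \<omega>)\<^sup>2 - v t)" for n \<omega>
  define Q where "Q n \<omega> = (\<Sum>t=1..n. ?Z t \<omega>)" for n \<omega>
  have [measurable]: "P n \<in> borel_measurable M" "Q n \<in> borel_measurable M" for n
    unfolding P_def[abs_def] Q_def[abs_def] by measurable

  have Qi: "integrable M (\<lambda>\<omega>. (Q n \<omega>)\<^sup>2)" for n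
    unfolding Q_def by (rule integral_square_sum(1)[OF integrable_filtered_product])
  have Q2: "(\<integral>\<omega>. (Q n \<omega>)\<^sup>2 \<partial>M) \<le> K * real n powr (2 - \<beta>)" if "1 \<le> n" for n
  proof -
    have "(\<integral>\<omega>. (Q n \<omega>)\<^sup>2 \<partial>M) = (\<Sum>s=1..n. \<Sum>t=1..n. filtered_cov \<theta> s t)"
      unfolding Q_def filtered_cov_def by (rule integral_square_sum(2)[OF integrable_filtered_product])
    also have "\<dots> \<le> (\<Sum>s=1..n. \<Sum>t=1..n. \<bar>filtered_cov \<theta> s t\<bar>)" by (intro sum_mono) simp
    also note K(2)[OF that]
    finally show ?thesis .
  qed

  have iZ2: "integrable M (\<lambda>\<omega>. (?Z t \<omega>)\<^sup>2)" and vZ: "(\<integral>\<omega>. (?Z t \<omega>)\<^sup>2 \<partial>M) = v t" for t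
    using integrable_filtered_product[of \<theta> t t] by (simp_all add: v_def filtered_cov_def power2_eq_square)
  have expand: "((?Z s \<omega>)\<^sup>2 - v s) * ((?Z t \<omega>)\<^sup>2 - v t)
      = (?Z s \<omega>)\<^sup>2 * (?Z t \<omega>)\<^sup>2 - v t * (?Z s \<omega>)\<^sup>2 - v s * (?Z t \<omega>)\<^sup>2 + v s * v t" for s t \<omega>
    by (simp add: algebra_simps)
  have ci: "integrable M (\<lambda>\<omega>. ((?Z s \<omega>)\<^sup>2 - v s) * ((?Z t \<omega>)\<^sup>2 - v t))" for s t
    unfolding expand by (intro Bochner_Integration.integrable_add Bochner_Integration.integrable_diff
        filtered_square_product integrable_mult_right iZ2) simp
  \<comment> \<open>Centring cancels the product of variances in Isserlis' identity.\<close>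
  have cv: "(\<integral>\<omega>. ((?Z s \<omega>)\<^sup>2 - v s) * ((?Z t \<omega>)\<^sup>2 - v t) \<partial>M) = 2 * (filtered_cov \<theta> s t)\<^sup>2" for s t
    unfolding expand using filtered_square_product[of \<theta> s t] iZ2
    by (simp add: vZ prob_space v_def[symmetric])
  have Pi: "integrable M (\<lambda>\<omega>. (P n \<omega>)\<^sup>2)" for n
    unfolding P_def by (rule integral_square_sum(1)[OF ci])
  have P2: "(\<integral>\<omega>. (P n \<omega>)\<^sup>2 \<partial>M) \<le> (2 * B * K) * real n powr (2 - \<beta>)" if "1 \<le> n" for n
  proof -
    have "(\<integral>\<omega>. (P n \<omega>)\<^sup>2 \<partial>M) = (\<Sum>s=1..n. \<Sum>t=1..n. 2 * (filtered_cov \<theta> s t)\<^sup>2)"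
      unfolding P_def by (subst integral_square_sum(2)[OF ci]) (simp only: cv)
    \<comment> \<open>One factor of each squared covariance is replaced by the uniform bound
      \<open>B\<close>. Linear decay then suffices, without distinguishing whether the squares of
      \<open>R\<close> are summable.\<close>
    also have "\<dots> \<le> (\<Sum>s=1..n. \<Sum>t=1..n. 2 * (B * \<bar>filtered_cov \<theta> s t\<bar>))"
    proof (intro sum_mono mult_left_mono)
      show "(filtered_cov \<theta> s t)\<^sup>2 \<le> B * \<bar>filtered_cov \<theta> s t\<bar>" for s t
        using mult_right_mono[OF cB[of s t], of "\<bar>filtered_cov \<theta> s t\<bar>"] by (simp add: power2_eq_square abs_mult_self_eq)
    qed simp
    also have "\<dots> = 2 * B * (\<Sum>s=1..n. \<Sum>t=1..n. \<bar>filtered_cov \<theta> s t\<bar>)"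
      by (simp add: sum_distrib_left mult_ac)
    also have "\<dots> \<le> 2 * B * (K * real n powr (2 - \<beta>))"
      using cB[of 0 0] by (intro mult_left_mono K that) auto
    finally show ?thesis by (simp add: mult_ac)
  qed

  \<comment> \<open>The law of large numbers at hand needs nonnegative summands; the signed averages \<open>Q n / n\<close> are
    recovered from those of \<open>(Z + 1)\<^sup>2 - Z\<^sup>2\<close>.\<close>
  have bound: "(P n \<omega> + 2 * Q n \<omega>)\<^sup>2 \<le> 2 * (P n \<omega>)\<^sup>2 + 8 * (Q n \<omega>)\<^sup>2" for n \<omega>
    using zero_le_power2[of "P n \<omega> - 2 * Q n \<omega>"] by (simp add: power2_eq_square algebra_simps)
  have PQ: "(\<Sum>t=1..n. (?Z t \<omega> + 1)\<^sup>2 - (v t + 1)) = P n \<omega> + 2 * Q n \<omega>" for n \<omega>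
    unfolding P_def Q_def sum_distrib_left sum.distrib[symmetric]
    by (intro sum.cong) (auto simp: power2_eq_square algebra_simps)
  have Si: "integrable M (\<lambda>\<omega>. 2 * (P n \<omega>)\<^sup>2 + 8 * (Q n \<omega>)\<^sup>2)" for n
    by (intro Bochner_Integration.integrable_add integrable_mult_right Pi Qi)
  have PQi: "integrable M (\<lambda>\<omega>. (P n \<omega> + 2 * Q n \<omega>)\<^sup>2)" for n
    by (rule Bochner_Integration.integrable_bound[OF Si[of n]]) (use bound in auto)
  have PQ2: "(\<integral>\<omega>. (P n \<omega> + 2 * Q n \<omega>)\<^sup>2 \<partial>M) \<le> (2 * (2 * B * K) + 8 * K) * real n powr (2 - \<beta>)"
    if "1 \<le> n" for n
  proof -
    have "(\<integral>\<omega>. (P n \<omega> + 2 * Q n \<omega>)\<^sup>2 \<partial>M) \<le> (\<integral>\<omega>. 2 * (P n \<omega>)\<^sup>2 + 8 * (Q n \<omega>)\<^sup>2 \<partial>M)"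
      by (intro integral_mono PQi Si bound)
    also have "\<dots> = 2 * (\<integral>\<omega>. (P n \<omega>)\<^sup>2 \<partial>M) + 8 * (\<integral>\<omega>. (Q n \<omega>)\<^sup>2 \<partial>M)"
      using Pi Qi by simp
    finally show ?thesis using P2[OF that] Q2[OF that] by (simp add: distrib_right)
  qed
  have vB: "\<bar>v t\<bar> \<le> B" "\<bar>v t + 1\<bar> \<le> B + 1" for t using cB[of t t] by (auto simp: v_def)
  have P0: "AE \<omega> in M. (\<lambda>n. P n \<omega> / real n) \<longlonglongrightarrow> 0"
    unfolding P_def
    by (rule AE_cesaro_of_second_moment_bound[OF _ vB(1) \<beta>(1)]) (use Pi P2 in \<open>auto simp: P_def\<close>)
  then show "AE \<omega> in M. (\<lambda>n. (\<Sum>t=1..n. (filtered \<theta> t \<omega>)\<^sup>2 - filtered_cov \<theta> t t) / real n) \<longlonglongrightarrow> 0"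
    unfolding P_def v_def .
  have "AE \<omega> in M. (\<lambda>n. (\<Sum>t=1..n. (?Z t \<omega> + 1)\<^sup>2 - (v t + 1)) / real n) \<longlonglongrightarrow> 0"
    by (rule AE_cesaro_of_second_moment_bound[OF _ vB(2) \<beta>(1), where K = "2 * (2 * B * K) + 8 * K"])
       (simp_all only: PQ PQi PQ2 zero_le_power2)
  with P0 show "AE \<omega> in M. (\<lambda>n. (\<Sum>t=1..n. filtered \<theta> t \<omega>) / real n) \<longlonglongrightarrow> 0"
  proof eventually_elim
    case (elim \<omega>)
    have "(\<lambda>n. ((P n \<omega> + 2 * Q n \<omega>) / real n - P n \<omega> / real n) / 2) \<longlonglongrightarrow> (0 - 0) / 2"
      using elim unfolding PQ by (intro tendsto_intros) auto
    then show ?case by (simp add: Q_def add_divide_distrib)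
  qed
qed

end

section \<open>Consistency of the estimators\<close>

lemma sample_variance_eq:
  assumes "1 \<le> n"
  shows "sample_variance X n \<omega> = (\<Sum>t=1..n. (X t \<omega>)\<^sup>2) / real n - (sample_mean X n \<omega>)\<^sup>2"
proof -
  define m where "m = sample_mean X n \<omega>"
  have m: "(\<Sum>t=1..n. X t \<omega>) = real n * m" using assms by (simp add: m_def sample_mean_def)
  have "(\<Sum>t=1..n. (X t \<omega> - m)\<^sup>2) = (\<Sum>t=1..n. (X t \<omega>)\<^sup>2 - 2 * m * X t \<omega> + m\<^sup>2)"
    by (intro sum.cong) (auto simp: power2_eq_square algebra_simps)
  also have "\<dots> = (\<Sum>t=1..n. (X t \<omega>)\<^sup>2) - 2 * m * (real n * m) + real n * m\<^sup>2"
    by (simp add: sum.distrib sum_subtractf m[unfolded One_nat_def] flip: sum_distrib_left)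
  finally show ?thesis
    unfolding sample_variance_def m_def[symmetric] using assms by (simp add: field_simps power2_eq_square)
qed

text \<open>The zero initial value leaves a transient \<open>\<mu> * \<theta> ^ t\<close>. Its
  product with \<open>Z\<close> averages to 0 by Cauchy-Schwarz, since the averages of its squares
  vanish while those of \<open>(Z t)\<^sup>2\<close> converge. Subtracting the squared mean removes
  the constant \<open>\<mu>\<^sup>2\<close>.\<close>

lemma sample_moments_LIMSEQ:
  fixes Z :: "nat \<Rightarrow> real"
  assumes \<theta>: "0 < \<theta>" "\<theta> < 1" and X: "\<And>t. X t \<omega> = \<mu> * (1 - \<theta> ^ t) + Z t"
    and Z1: "(\<lambda>n. (\<Sum>t=1..n. Z t) / real n) \<longlonglongrightarrow> 0"
    and Z2: "(\<lambda>n. (\<Sum>t=1..n. (Z t)\<^sup>2) / real n) \<longlonglongrightarrow> F"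
  shows "(\<lambda>n. sample_mean X n \<omega>) \<longlonglongrightarrow> \<mu>" and "(\<lambda>n. sample_variance X n \<omega>) \<longlonglongrightarrow> F"
proof -
  have p0: "(\<lambda>t. \<theta> ^ t) \<longlonglongrightarrow> 0" using \<theta> by (intro LIMSEQ_realpow_zero) auto
  have d1: "(\<lambda>n. (\<Sum>t=1..n. \<mu> * (1 - \<theta> ^ t)) / real n) \<longlonglongrightarrow> \<mu> * (1 - 0)"
    by (intro LIMSEQ_cesaro tendsto_intros p0)
  have d2: "(\<lambda>n. (\<Sum>t=1..n. (\<mu> * (1 - \<theta> ^ t))\<^sup>2) / real n) \<longlonglongrightarrow> (\<mu> * (1 - 0))\<^sup>2"
    by (intro LIMSEQ_cesaro tendsto_intros p0)
  have "(\<lambda>n. (\<Sum>t=1..n. (\<theta> ^ t)\<^sup>2) / real n) \<longlonglongrightarrow> 0\<^sup>2"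
    by (intro LIMSEQ_cesaro tendsto_intros p0)
  from tendsto_real_sqrt[OF tendsto_mult[OF this Z2]]
  have cs: "(\<lambda>n. sqrt ((\<Sum>t=1..n. (\<theta> ^ t)\<^sup>2) / real n * ((\<Sum>t=1..n. (Z t)\<^sup>2) / real n))) \<longlonglongrightarrow> 0"
    by simp
  have "norm ((\<Sum>t=1..n. \<theta> ^ t * Z t) / real n)
      \<le> sqrt ((\<Sum>t=1..n. (\<theta> ^ t)\<^sup>2) / real n * ((\<Sum>t=1..n. (Z t)\<^sup>2) / real n))" for n
  proof (rule real_le_rsqrt)
    have "((\<Sum>t=1..n. \<theta> ^ t * Z t) / real n)\<^sup>2 = (\<Sum>t=1..n. \<theta> ^ t * Z t)\<^sup>2 / (real n)\<^sup>2"
      by (rule power_divide)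
    also have "\<dots> \<le> ((\<Sum>t=1..n. (\<theta> ^ t)\<^sup>2) * (\<Sum>t=1..n. (Z t)\<^sup>2)) / (real n)\<^sup>2"
      by (intro divide_right_mono Cauchy_Schwarz_ineq_sum) simp
    finally show "(norm ((\<Sum>t=1..n. \<theta> ^ t * Z t) / real n))\<^sup>2
        \<le> (\<Sum>t=1..n. (\<theta> ^ t)\<^sup>2) / real n * ((\<Sum>t=1..n. (Z t)\<^sup>2) / real n)"
      by (simp add: power2_eq_square)
  qed
  then have cross: "(\<lambda>n. (\<Sum>t=1..n. \<theta> ^ t * Z t) / real n) \<longlonglongrightarrow> 0"
    using cs by (rule Lim_null_comparison[OF always_eventually[OF allI]])

  have mean: "sample_mean X n \<omega> = (\<Sum>t=1..n. \<mu> * (1 - \<theta> ^ t)) / real n + (\<Sum>t=1..n. Z t) / real n" for n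
    by (simp only: sample_mean_def X sum.distrib add_divide_distrib times_divide_eq_left mult_1)
  show m: "(\<lambda>n. sample_mean X n \<omega>) \<longlonglongrightarrow> \<mu>"
    unfolding mean using tendsto_add[OF d1 Z1] by simp
  have sq: "(\<Sum>t=1..n. (X t \<omega>)\<^sup>2) / real n = (\<Sum>t=1..n. (\<mu> * (1 - \<theta> ^ t))\<^sup>2) / real n
      + 2 * \<mu> * ((\<Sum>t=1..n. Z t) / real n) - 2 * \<mu> * ((\<Sum>t=1..n. \<theta> ^ t * Z t) / real n)
      + (\<Sum>t=1..n. (Z t)\<^sup>2) / real n" for n
  proof -
    have "(\<Sum>t=1..n. (X t \<omega>)\<^sup>2)
        = (\<Sum>t=1..n. (\<mu> * (1 - \<theta> ^ t))\<^sup>2 + 2 * \<mu> * Z t - 2 * \<mu> * (\<theta> ^ t * Z t) + (Z t)\<^sup>2)"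
      unfolding X by (intro sum.cong refl) (simp add: power2_eq_square algebra_simps)
    also have "\<dots> = (\<Sum>t=1..n. (\<mu> * (1 - \<theta> ^ t))\<^sup>2) + 2 * \<mu> * (\<Sum>t=1..n. Z t)
        - 2 * \<mu> * (\<Sum>t=1..n. \<theta> ^ t * Z t) + (\<Sum>t=1..n. (Z t)\<^sup>2)"
      by (simp only: sum.distrib sum_subtractf sum_distrib_left)
    finally show ?thesis by (simp add: add_divide_distrib diff_divide_distrib)
  qed
  have "(\<lambda>n. (\<Sum>t=1..n. (X t \<omega>)\<^sup>2) / real n - (sample_mean X n \<omega>)\<^sup>2)
      \<longlonglongrightarrow> ((\<mu> * (1 - 0))\<^sup>2 + 2 * \<mu> * 0 - 2 * \<mu> * 0 + F) - \<mu>\<^sup>2"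
    unfolding sq by (intro tendsto_intros d2 Z1 cross Z2 m)
  then have "(\<lambda>n. (\<Sum>t=1..n. (X t \<omega>)\<^sup>2) / real n - (sample_mean X n \<omega>)\<^sup>2) \<longlonglongrightarrow> F" by simp
  then show "(\<lambda>n. sample_variance X n \<omega>) \<longlonglongrightarrow> F"
    by (rule Lim_transform_eventually)
       (auto simp: sample_variance_eq intro!: eventually_sequentiallyI[of 1])
qed

text \<open>Once the sample variance lies strictly between \<open>f l\<close> and
  \<open>f u\<close>, the intermediate value theorem puts it in the range of \<open>f\<close>, and
  injectivity places its preimage between \<open>l\<close> and \<open>u\<close>. This gives
  continuity of the inverse and shows that the fallback value \<open>g\<close> is eventually not
  taken.\<close>

lemma theta_hat_LIMSEQ:
  assumes mono: "strict_mono_on {0<..<1} f" and cont: "\<And>x. 0 < x \<Longrightarrow> x < 1 \<Longrightarrow> isCont f x"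
    and \<theta>: "0 < \<theta>" "\<theta> < 1" and sv: "(\<lambda>n. sample_variance X n \<omega>) \<longlonglongrightarrow> f \<theta>"
  shows "(\<lambda>n. theta_hat f g X n \<omega>) \<longlonglongrightarrow> \<theta>"
proof -
  have inj: "inj_on f {0<..<1}" using mono by (rule strict_mono_on_imp_inj_on)
  have near: "\<forall>\<^sub>F n in sequentially. l < theta_hat f g X n \<omega> \<and> theta_hat f g X n \<omega> < u"
    if lu: "0 < l" "l < \<theta>" "\<theta> < u" "u < 1" for l u
  proof -
    have "f l < f \<theta>" "f \<theta> < f u"
      using lu \<theta> by (auto intro: strict_mono_onD[OF mono])
    with sv have "\<forall>\<^sub>F n in sequentially. f l < sample_variance X n \<omega>"
      "\<forall>\<^sub>F n in sequentially. sample_variance X n \<omega> < f u"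
      by (auto dest: order_tendstoD)
    then show ?thesis
    proof eventually_elim
      case (elim n)
      have "\<exists>x\<ge>l. x \<le> u \<and> f x = sample_variance X n \<omega>"
        using elim lu cont by (intro IVT) auto
      then obtain x where x: "l \<le> x" "x \<le> u" "f x = sample_variance X n \<omega>" by blast
      then have "l \<noteq> x" "x \<noteq> u" using elim by auto
      with x have "l < x" "x < u" by auto
      moreover have "theta_hat f g X n \<omega> = x"
      proof -
        have "x \<in> {0<..<1}" using x lu by auto
        then have "sample_variance X n \<omega> \<in> f ` {0<..<1}" unfolding x(3)[symmetric] by (rule imageI)
        with the_inv_into_f_f[OF inj \<open>x \<in> {0<..<1}\<close>] show ?thesis by (simp add: theta_hat_def x(3))
      qed
      ultimately show ?case by simp
    qed
  qed
  show ?thesis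
  proof (rule order_tendstoI)
    fix a assume "a < \<theta>"
    then show "\<forall>\<^sub>F n in sequentially. a < theta_hat f g X n \<omega>"
      \<comment> \<open>The maximum with \<open>\<theta> / 2\<close> keeps the lower end positive
        even when \<open>a\<close> is not; the minimum below likewise keeps the upper end under
        1.\<close>
      using near[of "max a (\<theta> / 2)" "(\<theta> + 1) / 2"] \<theta> by (auto simp: less_max_iff_disj elim: eventually_mono)
  next
    fix a assume "\<theta> < a"
    then show "\<forall>\<^sub>F n in sequentially. theta_hat f g X n \<omega> < a"
      using near[of "\<theta> / 2" "min a ((\<theta> + 1) / 2)"] \<theta> by (auto simp: min_less_iff_disj elim: eventually_mono)
  qed
qed

theorem theorem1p2:
  fixes M :: "'a measure"
    and \<xi> :: "int \<Rightarrow> 'a \<Rightarrow> real"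
    and X g :: "nat \<Rightarrow> 'a \<Rightarrow> real"
    and f :: "real \<Rightarrow> real"
    and \<alpha> \<theta> H C :: real
  defines "f \<equiv> second_moment M \<xi>"
  assumes "prob_space M"
    and "0 < \<theta>" "\<theta> < 1"
    and "1 / 2 < H" "H < 1" "0 < C"
    and "gaussian_process M \<xi>" "zero_mean M \<xi>" "stationary M \<xi>"
    and "((\<lambda>k::int. autocov M \<xi> k / (C * real_of_int \<bar>k\<bar> powr (2 * H - 2))) \<longlongrightarrow> 1) at_top"
    and "\<And>\<omega>. \<omega> \<in> space M \<Longrightarrow> X 0 \<omega> = 0"
    and "\<And>t \<omega>. 1 \<le> t \<Longrightarrow> \<omega> \<in> space M \<Longrightarrow> X t \<omega> = \<alpha> + \<theta> * X (t - 1) \<omega> + \<xi> (int t) \<omega>"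
    and "\<And>x. 0 < x \<Longrightarrow> x < 1 \<Longrightarrow> 0 < f x"
    and "strict_mono_on {0<..<1} f"
    and "\<And>n. g n \<in> borel_measurable M"
  shows "(AE \<omega> in M. (\<lambda>n. theta_hat f g X n \<omega>) \<longlonglongrightarrow> \<theta>) \<and>
         (AE \<omega> in M. (\<lambda>n. alpha_hat f g X n \<omega>) \<longlonglongrightarrow> \<alpha>)"
proof -
  note \<theta> = assms(3,4)
  interpret prob_space M by fact
  interpret stationary_gaussian_noise M \<xi> by unfold_locales fact+
  define \<beta> where "\<beta> = 2 - 2 * H"
  have \<beta>: "0 < \<beta>" "\<beta> < 1" using assms by (auto simp: \<beta>_def)
  \<comment> \<open>The fixed point of \<open>x = \<alpha> + \<theta> * x\<close>, and the limit of
    the sample mean.\<close>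
  define \<mu> where "\<mu> = \<alpha> / (1 - \<theta>)"
  \<comment> \<open>Convergence of the ratio makes it bounded over all \<open>k\<close>, which turns
    the asymptotic relation into an inequality for every \<open>k \<ge> 1\<close>. At
    \<open>k = 0\<close> the quotient is 0 by the convention for division by zero.\<close>
  obtain A where decay: "\<And>k. 1 \<le> k \<Longrightarrow> \<bar>R (int k)\<bar> \<le> A * real k powr (- \<beta>)"
  proof -
    have "(\<lambda>k. R (int k) / (C * real_of_int \<bar>int k\<bar> powr (2 * H - 2))) \<longlonglongrightarrow> 1"
      by (rule filterlim_compose[OF assms(11) filterlim_int_sequentially])
    then have "Bseq (\<lambda>k. R (int k) / (C * real k powr (- \<beta>)))"
      by (auto simp: \<beta>_def intro: convergent_imp_Bseq convergentI)
    then obtain K where K: "\<And>k. \<bar>R (int k) / (C * real k powr (- \<beta>))\<bar> \<le> K"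
      unfolding Bseq_def real_norm_def by blast
    show ?thesis
    proof (rule that)
      fix k :: nat assume "1 \<le> k"
      then show "\<bar>R (int k)\<bar> \<le> (K * C) * real k powr (- \<beta>)"
        using K[of k] \<open>0 < C\<close> by (simp add: abs_divide abs_mult pos_divide_le_eq mult_ac)
    qed
  qed
  have X: "X t \<omega> = \<mu> * (1 - \<theta> ^ t) + filtered \<theta> t \<omega>" if "\<omega> \<in> space M" for t \<omega>
  proof (induction t)
    case 0
    then show ?case using assms(12)[OF that] by (simp add: filtered_def)
  next
    case (Suc t)
    have "\<alpha> = (1 - \<theta>) * \<mu>" using \<theta> by (simp add: \<mu>_def)
    then show ?case
      using assms(13)[of "Suc t", OF _ that] Suc by (simp add: filtered_Suc algebra_simps)
  qed
  have avg: "AE \<omega> in M. (\<lambda>n. (\<Sum>t=1..n. (filtered \<theta> t \<omega>)\<^sup>2 - filtered_cov \<theta> t t) / real n) \<longlonglongrightarrow> 0"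
      "AE \<omega> in M. (\<lambda>n. (\<Sum>t=1..n. filtered \<theta> t \<omega>) / real n) \<longlonglongrightarrow> 0"
    by (rule AE_cesaro_filtered[OF \<theta> \<beta>], erule decay)+
  have "AE \<omega> in M. (\<lambda>n. theta_hat f g X n \<omega>) \<longlonglongrightarrow> \<theta> \<and> (\<lambda>n. sample_mean X n \<omega>) \<longlonglongrightarrow> \<mu>"
    using avg AE_space
  proof eventually_elim
    case (elim \<omega>)
    \<comment> \<open>The variances of the filtered noise converge to \<open>f \<theta>\<close>,
      hence so do their averages; adding these back undoes the centring.\<close>
    have "(\<lambda>n. (\<Sum>t=1..n. (filtered \<theta> t \<omega>)\<^sup>2 - filtered_cov \<theta> t t) / real n
        + (\<Sum>t=1..n. filtered_cov \<theta> t t) / real n) \<longlonglongrightarrow> 0 + f \<theta>"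
      unfolding f_def
      by (intro tendsto_add elim(1) LIMSEQ_cesaro filtered_cov_diagonal_LIMSEQ \<theta>)
    then have "(\<lambda>n. (\<Sum>t=1..n. (filtered \<theta> t \<omega>)\<^sup>2) / real n) \<longlonglongrightarrow> f \<theta>"
      by (simp add: add_divide_distrib[symmetric] sum_subtractf)
    note lims = sample_moments_LIMSEQ[of \<theta> X \<omega>, OF \<theta> X[OF elim(3)] elim(2) this]
    show ?case
      using theta_hat_LIMSEQ[OF assms(15) _ \<theta> lims(2)] isCont_second_moment lims(1)
      by (simp add: f_def)
  qed
  then show ?thesis
  proof (intro conjI)
    assume *: "AE \<omega> in M. (\<lambda>n. theta_hat f g X n \<omega>) \<longlonglongrightarrow> \<theta> \<and> (\<lambda>n. sample_mean X n \<omega>) \<longlonglongrightarrow> \<mu>"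
    then show "AE \<omega> in M. (\<lambda>n. theta_hat f g X n \<omega>) \<longlonglongrightarrow> \<theta>" by eventually_elim simp
    from * show "AE \<omega> in M. (\<lambda>n. alpha_hat f g X n \<omega>) \<longlonglongrightarrow> \<alpha>"
    proof eventually_elim
      case (elim \<omega>)
      then have "(\<lambda>n. alpha_hat f g X n \<omega>) \<longlonglongrightarrow> (1 - \<theta>) * \<mu>"
        unfolding alpha_hat_def by (intro tendsto_intros) auto
      then show ?case using \<theta> by (simp add: \<mu>_def)
    qed
  qed
qed

end
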